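(* Let $M$ be a proper EMV-algebra (i.e. an EMV-algebra without top element) and let $r$ be a square root on $M$ with $r(0)>0$. Then there are a generalized Boolean algebra $M_1$ and a strict EMV-algebra $M_2=\Gamma(G_2,u_2)$, for some Abelian unital $\ell$-group $(G_2,u_2)$, such that, up to isomorphism, $M=M_1\times M_2$, and under this identification $$r(x_1,x_2)=\bigl(x_1,(x_2+u_2)/2\bigr)=x_1\vee\bigl((x_2+u_2)/2\bigr),\qquad (x_1,x_2)\in M,$$ where $+$ is the group addition in $G_2$ (the elements $(x_2+u_2)/2$ existing in $M_2$) and in the last expression $x_1$ and $(x_2+u_2)/2$ are identified with $(x_1,0)$ and $(0,(x_2+u_2)/2)$, respectively.
   Context: An EMV-algebra is an algebra $(M;\vee,\wedge,\oplus,0)$ of type $(2,2,2,0)$ such that: (E1) $(M;\vee,\wedge,0)$ is a distributive lattice with least element $0$; (E2) $(M;\oplus,0)$ is a commutative ordered monoid with neutral element $0$; (E3) writing $\mathcal I(M)=\{x\in M\mid x\oplus x=x\}$ (the idempotents), for each $a\in\mathcal I(M)$ and each $x\in[0,a]$ the element $\lambda_a(x)=\min\{z\in[0,a]\mid x\oplus z=a\}$ exists, and $([0,a];\oplus,\lambda_a,0,a)$ is an MV-algebra; (E4) for each $x\in M$ there is $a\in\mathcal I(M)$ with $x\le a$. For $x,y\in M$, $x\odot y:=\lambda_a(\lambda_a(x)\oplus\lambda_a(y))$ for any $a\in\mathcal I(M)$ with $x,y\le a$ (this does not depend on $a$). An EMV-algebra with top element $1$ is the same thing as an MV-algebra, with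 $x'=\lambda_1(x)$. A generalized Boolean algebra is a relatively complemented distributive lattice with bottom element, regarded as an EMV-algebra with $\oplus=\vee$. A square root on $M$ is a map $s:M\to M$ such that (Sq1) $s(x)\odot s(x)=x$ for all $x\in M$; (Sq2) for all $x,y\in M$, $y\odot y\le x$ implies $y\le s(x)$. For $b\in\mathcal I(M)$, $s_b(x)=s(x)\wedge b$ defines a square root on the MV-algebra $[0,b]$. An EMV-algebra $M$ with a square root $s$ is strict if, for each $b\in\mathcal I(M)$ with $b\ge s(0)$, $s_b(0)=\lambda_b(s_b(0))$. (A strict EMV-algebra has a top element, hence is an MV-algebra.) For an Abelian unital $\ell$-group $(G,u)$ ($u$ a strong unit), $\Gamma(G,u)$ is the MV-algebra on $[0,u]$ with $x\oplus y=(x+y)\wedge u$, $x'=u-x$; every MV-algebra is of this form up to isomorphism. $g/2$ denotes the unique $h\in G$ with $h+h=g$, if it exists. *)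

theory Defs
  imports "HOL-Algebra.Group"
begin

section \<open>MV-algebras and EMV-algebras\<close>

locale mv_algebra =
  fixes A :: "'a set" and pl :: "'a \<Rightarrow> 'a \<Rightarrow> 'a" and neg :: "'a \<Rightarrow> 'a" and z e :: 'a
  assumes pl_comm_monoid: "comm_monoid \<lparr>carrier = A, mult = pl, one = z\<rparr>"
    and neg_closed: "x \<in> A \<Longrightarrow> neg x \<in> A"
    and neg_neg: "x \<in> A \<Longrightarrow> neg (neg x) = x"
    and neg_zero: "neg z = e"
    and pl_top: "x \<in> A \<Longrightarrow> pl x e = e"
    and lukasiewicz: "\<lbrakk>x \<in> A; y \<in> A\<rbrakk> \<Longrightarrow> pl x (neg (pl x (neg y))) = pl y (neg (pl y (neg x)))"

record 'a emv = "'a partial_object" +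
  emv_join :: "'a \<Rightarrow> 'a \<Rightarrow> 'a"  (infixl \<open>\<^bold>\<or>\<index>\<close> 65)
  emv_meet :: "'a \<Rightarrow> 'a \<Rightarrow> 'a"  (infixl \<open>\<^bold>\<and>\<index>\<close> 70)
  emv_plus :: "'a \<Rightarrow> 'a \<Rightarrow> 'a"  (infixl \<open>\<^bold>\<oplus>\<index>\<close> 65)
  emv_zero :: 'a               (\<open>\<^bold>\<zero>\<index>\<close>)

definition emv_order :: "('a, 'm) emv_scheme \<Rightarrow> 'a gorder" where
  "emv_order M = \<lparr>carrier = carrier M, eq = (=), le = (\<lambda>x y. x \<^bold>\<or>\<^bsub>M\<^esub> y = y)\<rparr>"

abbreviation emv_le  (infix \<open>\<^bold>\<le>\<index>\<close> 50) where
  "x \<^bold>\<le>\<^bsub>M\<^esub> y \<equiv> x \<sqsubseteq>\<^bsub>emv_order M\<^esub> y"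

abbreviation emv_less  (infix \<open>\<^bold><\<index>\<close> 50) where
  "x \<^bold><\<^bsub>M\<^esub> y \<equiv> x \<sqsubset>\<^bsub>emv_order M\<^esub> y"

definition emv_idem :: "('a, 'm) emv_scheme \<Rightarrow> 'a set" where
  "emv_idem M = {a \<in> carrier M. a \<^bold>\<oplus>\<^bsub>M\<^esub> a = a}"

abbreviation emv_segment :: "('a, 'm) emv_scheme \<Rightarrow> 'a \<Rightarrow> 'a set" where
  "emv_segment M a \<equiv> \<lbrace>\<^bold>\<zero>\<^bsub>M\<^esub>..a\<rbrace>\<^bsub>emv_order M\<^esub>"

definition emv_is_lam :: "('a, 'm) emv_scheme \<Rightarrow> 'a \<Rightarrow> 'a \<Rightarrow> 'a \<Rightarrow> bool" where
  "emv_is_lam M a x l \<longleftrightarrow> least (emv_order M) l {z \<in> emv_segment M a. x \<^bold>\<oplus>\<^bsub>M\<^esub> z = a}"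

definition emv_lam :: "('a, 'm) emv_scheme \<Rightarrow> 'a \<Rightarrow> 'a \<Rightarrow> 'a" where
  "emv_lam M a x = (THE l. emv_is_lam M a x l)"

locale distrib_lattice_bot =
  fixes M (structure)
  assumes join_closed: "\<lbrakk>x \<in> carrier M; y \<in> carrier M\<rbrakk> \<Longrightarrow> x \<^bold>\<or> y \<in> carrier M"
    and meet_closed: "\<lbrakk>x \<in> carrier M; y \<in> carrier M\<rbrakk> \<Longrightarrow> x \<^bold>\<and> y \<in> carrier M"
    and zero_closed: "\<^bold>\<zero> \<in> carrier M"
    and join_assoc: "\<lbrakk>x \<in> carrier M; y \<in> carrier M; z \<in> carrier M\<rbrakk> \<Longrightarrow> (x \<^bold>\<or> y) \<^bold>\<or> z = x \<^bold>\<or> (y \<^bold>\<or> z)"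
    and meet_assoc: "\<lbrakk>x \<in> carrier M; y \<in> carrier M; z \<in> carrier M\<rbrakk> \<Longrightarrow> (x \<^bold>\<and> y) \<^bold>\<and> z = x \<^bold>\<and> (y \<^bold>\<and> z)"
    and join_comm: "\<lbrakk>x \<in> carrier M; y \<in> carrier M\<rbrakk> \<Longrightarrow> x \<^bold>\<or> y = y \<^bold>\<or> x"
    and meet_comm: "\<lbrakk>x \<in> carrier M; y \<in> carrier M\<rbrakk> \<Longrightarrow> x \<^bold>\<and> y = y \<^bold>\<and> x"
    and join_meet_absorb: "\<lbrakk>x \<in> carrier M; y \<in> carrier M\<rbrakk> \<Longrightarrow> x \<^bold>\<or> (x \<^bold>\<and> y) = x"
    and meet_join_absorb: "\<lbrakk>x \<in> carrier M; y \<in> carrier M\<rbrakk> \<Longrightarrow> x \<^bold>\<and> (x \<^bold>\<or> y) = x"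
    and meet_join_distrib:
      "\<lbrakk>x \<in> carrier M; y \<in> carrier M; z \<in> carrier M\<rbrakk> \<Longrightarrow> x \<^bold>\<and> (y \<^bold>\<or> z) = (x \<^bold>\<and> y) \<^bold>\<or> (x \<^bold>\<and> z)"
    and zero_least: "x \<in> carrier M \<Longrightarrow> \<^bold>\<zero> \<^bold>\<le> x"

locale emv_algebra = distrib_lattice_bot M for M (structure) +
  assumes plus_comm_monoid: "comm_monoid \<lparr>carrier = carrier M, mult = (\<^bold>\<oplus>), one = \<^bold>\<zero>\<rparr>"
    and plus_mono: "\<lbrakk>x \<in> carrier M; y \<in> carrier M; z \<in> carrier M; x \<^bold>\<le> y\<rbrakk> \<Longrightarrow> x \<^bold>\<oplus> z \<^bold>\<le> y \<^bold>\<oplus> z"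
    and lam_exists: "\<lbrakk>a \<in> emv_idem M; x \<in> emv_segment M a\<rbrakk> \<Longrightarrow> \<exists>l. emv_is_lam M a x l"
    and segment_mv: "a \<in> emv_idem M \<Longrightarrow> mv_algebra (emv_segment M a) (\<^bold>\<oplus>) (emv_lam M a) \<^bold>\<zero> a"
    and idem_cofinal: "x \<in> carrier M \<Longrightarrow> \<exists>a \<in> emv_idem M. x \<^bold>\<le> a"

definition proper_emv_algebra :: "('a, 'm) emv_scheme \<Rightarrow> bool" where
  "proper_emv_algebra M \<longleftrightarrow> emv_algebra M \<and> \<not> (\<exists>t. greatest (emv_order M) t (carrier M))"

text \<open>The value does not depend on the idempotent \<open>a\<close> chosen above \<open>x\<close> and \<open>y\<close>.\<close>

definition emv_odot :: "('a, 'm) emv_scheme \<Rightarrow> 'a \<Rightarrow> 'a \<Rightarrow> 'a" where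
  "emv_odot M x y =
    (let a = (SOME a. a \<in> emv_idem M \<and> x \<^bold>\<le>\<^bsub>M\<^esub> a \<and> y \<^bold>\<le>\<^bsub>M\<^esub> a)
     in emv_lam M a (emv_lam M a x \<^bold>\<oplus>\<^bsub>M\<^esub> emv_lam M a y))"

section \<open>Generalized Boolean algebras, products and isomorphisms\<close>

locale generalized_boolean_emv = distrib_lattice_bot M for M (structure) +
  assumes rel_compl: "\<lbrakk>a \<in> carrier M; b \<in> carrier M; x \<in> carrier M; a \<^bold>\<le> x; x \<^bold>\<le> b\<rbrakk>
      \<Longrightarrow> \<exists>y \<in> carrier M. x \<^bold>\<and> y = a \<and> x \<^bold>\<or> y = b"
    and plus_eq_join: "\<lbrakk>x \<in> carrier M; y \<in> carrier M\<rbrakk> \<Longrightarrow> x \<^bold>\<oplus> y = x \<^bold>\<or> y"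

definition emv_prod :: "('a, 'm) emv_scheme \<Rightarrow> ('b, 'n) emv_scheme \<Rightarrow> ('a \<times> 'b) emv" where
  "emv_prod M N =
    \<lparr>carrier = carrier M \<times> carrier N,
     emv_join = (\<lambda>(x, y) (x', y'). (x \<^bold>\<or>\<^bsub>M\<^esub> x', y \<^bold>\<or>\<^bsub>N\<^esub> y')),
     emv_meet = (\<lambda>(x, y) (x', y'). (x \<^bold>\<and>\<^bsub>M\<^esub> x', y \<^bold>\<and>\<^bsub>N\<^esub> y')),
     emv_plus = (\<lambda>(x, y) (x', y'). (x \<^bold>\<oplus>\<^bsub>M\<^esub> x', y \<^bold>\<oplus>\<^bsub>N\<^esub> y')),
     emv_zero = (\<^bold>\<zero>\<^bsub>M\<^esub>, \<^bold>\<zero>\<^bsub>N\<^esub>)\<rparr>"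

definition emv_iso :: "('a, 'm) emv_scheme \<Rightarrow> ('b, 'n) emv_scheme \<Rightarrow> ('a \<Rightarrow> 'b) set" where
  "emv_iso M N = {f. bij_betw f (carrier M) (carrier N) \<and>
     (\<forall>x \<in> carrier M. \<forall>y \<in> carrier M.
        f (x \<^bold>\<or>\<^bsub>M\<^esub> y) = f x \<^bold>\<or>\<^bsub>N\<^esub> f y \<and>
        f (x \<^bold>\<and>\<^bsub>M\<^esub> y) = f x \<^bold>\<and>\<^bsub>N\<^esub> f y \<and>
        f (x \<^bold>\<oplus>\<^bsub>M\<^esub> y) = f x \<^bold>\<oplus>\<^bsub>N\<^esub> f y) \<and>
     f \<^bold>\<zero>\<^bsub>M\<^esub> = \<^bold>\<zero>\<^bsub>N\<^esub>}"

section \<open>Square roots\<close>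

definition emv_square_root :: "('a, 'm) emv_scheme \<Rightarrow> ('a \<Rightarrow> 'a) \<Rightarrow> bool" where
  "emv_square_root M s \<longleftrightarrow>
     s \<in> carrier M \<rightarrow> carrier M \<and>
     (\<forall>x \<in> carrier M. emv_odot M (s x) (s x) = x) \<and>
     (\<forall>x \<in> carrier M. \<forall>y \<in> carrier M. emv_odot M y y \<^bold>\<le>\<^bsub>M\<^esub> x \<longrightarrow> y \<^bold>\<le>\<^bsub>M\<^esub> s x)"

definition emv_root_restrict :: "('a, 'm) emv_scheme \<Rightarrow> ('a \<Rightarrow> 'a) \<Rightarrow> 'a \<Rightarrow> 'a \<Rightarrow> 'a" where
  "emv_root_restrict M s b x = s x \<^bold>\<and>\<^bsub>M\<^esub> b"

definition strict_emv_algebra :: "('a, 'm) emv_scheme \<Rightarrow> ('a \<Rightarrow> 'a) \<Rightarrow> bool" where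
  "strict_emv_algebra M s \<longleftrightarrow> emv_algebra M \<and> emv_square_root M s \<and>
     (\<forall>b \<in> emv_idem M. s \<^bold>\<zero>\<^bsub>M\<^esub> \<^bold>\<le>\<^bsub>M\<^esub> b \<longrightarrow>
        emv_root_restrict M s b \<^bold>\<zero>\<^bsub>M\<^esub> = emv_lam M b (emv_root_restrict M s b \<^bold>\<zero>\<^bsub>M\<^esub>))"

section \<open>Abelian unital lattice-ordered groups\<close>

text \<open>The group is an HOL-Algebra group, hence written multiplicatively: \<open>x \<otimes> y\<close> is the
  sum \<open>x + y\<close>, \<open>\<one>\<close> is the neutral element \<open>0\<close>, and \<open>x [^] n\<close> is \<open>n x\<close>.\<close>

record 'a lgroup = "'a monoid" +
  lg_le :: "'a \<Rightarrow> 'a \<Rightarrow> bool"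

definition lg_order :: "('a, 'm) lgroup_scheme \<Rightarrow> 'a gorder" where
  "lg_order G = \<lparr>carrier = carrier G, eq = (=), le = lg_le G\<rparr>"

locale abelian_lgroup = comm_group G for G (structure) +
  assumes order_lattice: "lattice (lg_order G)"
    and translation_mono:
      "\<lbrakk>x \<in> carrier G; y \<in> carrier G; z \<in> carrier G; lg_le G x y\<rbrakk> \<Longrightarrow> lg_le G (x \<otimes> z) (y \<otimes> z)"

locale abelian_unital_lgroup = abelian_lgroup G for G (structure) and u +
  assumes unit_closed: "u \<in> carrier G"
    and unit_nonneg: "lg_le G \<one> u"
    and strong_unit: "g \<in> carrier G \<Longrightarrow> \<exists>n::nat. lg_le G g (u [^] n)"

text \<open>\<open>\<Gamma>(G, u)\<close> as an EMV-algebra. Its MV-negation \<open>u - x\<close> is not a separate operation: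
  it is \<open>\<lambda>\<^sub>u(x)\<close>, determined by \<open>\<oplus>\<close> and the order.\<close>

definition mv_Gamma :: "('a, 'm) lgroup_scheme \<Rightarrow> 'a \<Rightarrow> 'a emv" where
  "mv_Gamma G u =
    \<lparr>carrier = \<lbrace>\<one>\<^bsub>G\<^esub>..u\<rbrace>\<^bsub>lg_order G\<^esub>,
     emv_join = (\<lambda>x y. x \<squnion>\<^bsub>lg_order G\<^esub> y),
     emv_meet = (\<lambda>x y. x \<sqinter>\<^bsub>lg_order G\<^esub> y),
     emv_plus = (\<lambda>x y. (x \<otimes>\<^bsub>G\<^esub> y) \<sqinter>\<^bsub>lg_order G\<^esub> u),
     emv_zero = \<one>\<^bsub>G\<^esub>\<rparr>"

text \<open>\<open>lg_half G g\<close> is \<open>g/2\<close>; it is meaningful only if \<open>lg_has_half G g\<close>.\<close>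

definition lg_has_half :: "('a, 'm) lgroup_scheme \<Rightarrow> 'a \<Rightarrow> bool" where
  "lg_has_half G g \<longleftrightarrow> (\<exists>!h. h \<in> carrier G \<and> h \<otimes>\<^bsub>G\<^esub> h = g)"

definition lg_half :: "('a, 'm) lgroup_scheme \<Rightarrow> 'a \<Rightarrow> 'a" where
  "lg_half G g = (THE h. h \<in> carrier G \<and> h \<otimes>\<^bsub>G\<^esub> h = g)"

text \<open>HOL cannot quantify existentially over types, so a theorem asserting that some group exists
  must name the type of its elements. For an MV-algebra with elements in \<open>'a\<close> we use sets of pairs
  from \<open>nat \<times> 'a\<close>:
  the group is 2-divisible here, and in a 2-divisible unital group every element has the form
  \<open>2\<^sup>n(2x - u)\<close> with \<open>x \<in> [0, u]\<close>, and is thus an equivalence class of pairs \<open>(n, x)\<close>.\<close>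

type_synonym 'a unital_lgroup_over = "((nat \<times> 'a) set) lgroup"

end

theory Submission
  imports Defs
begin

text \<open>Put \<open>u = r(0) \<oplus> r(0)\<close>. For an idempotent \<open>b\<close> above \<open>r(0)\<close>, the halving
  \<open>h(x) = b - r(b - x)\<close> is the least \<open>y\<close> with \<open>x \<le> y \<oplus> y\<close>, hence additive on sums
  that do not overflow. Additivity gives \<open>h(v) = v\<close> for \<open>v = b - u\<close>, so \<open>u\<close> and \<open>v\<close> are
  idempotent, every element below \<open>v\<close> is idempotent, and \<open>x \<mapsto> (x - u, x \<and> u)\<close> splits \<open>M\<close>
  into a generalized Boolean algebra and the MV-algebra \<open>[0,u]\<close>. On \<open>[0,u]\<close> one has
  \<open>h(u) = u - h(u)\<close>, which makes \<open>(x + y)/2 = h(x) \<oplus> h(y)\<close> a cancellative medial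
  operation. The unital group of \<open>[0,u]\<close> is the direct limit of copies of \<open>[0,u]\<close> along
  \<open>x \<mapsto> x/2 + u/4\<close>, the \<open>x\<close> at stage \<open>n\<close> standing for \<open>2\<^sup>n(2x - u)\<close>, and addition
  sends two elements of one stage to their midpoint at the next.\<close>

section \<open>Residuation in EMV-algebras\<close>

text \<open>A proper \<open>M\<close> has no top, so \<open>u\<close> has no complement in
  \<open>M\<close> and no single \<open>\<lambda>\<^sub>a\<close> covers all elements. The truncated
  difference is therefore introduced by an adjunction that mentions no idempotent:
  \<open>x \<ominus> u\<close> can then serve as the component of \<open>x\<close> outside
  \<open>u\<close>, and facts found in different segments \<open>[0,b]\<close> fit together. Passing
  from the root to a halving replaces \<open>\<odot>\<close> by \<open>\<oplus>\<close> and the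
  order. Leastness is essential there: the sum is truncated, so \<open>y \<oplus> y = b\<close> may
  have many solutions. The copies of \<open>[0,u]\<close> in the limit are centred at
  \<open>u/2\<close> because \<open>x \<mapsto> u - x\<close> is then negation at every stage.
  Elements of both signs appear without formal differences, and a midpoint never overflows, so
  addition is total. This takes the place of the good sequences that a general MV-algebra would
  require.\<close>

context distrib_lattice_bot
begin

lemmas closed [simp] = join_closed meet_closed zero_closed

lemma le_iff_join: "x \<^bold>\<le> y \<longleftrightarrow> x \<^bold>\<or> y = y"
  by (simp add: emv_order_def)

lemma join_idem: "x \<in> carrier M \<Longrightarrow> x \<^bold>\<or> x = x"
  by (metis join_meet_absorb meet_join_absorb join_closed)

lemma zero_join [simp]: "x \<in> carrier M \<Longrightarrow> \<^bold>\<zero> \<^bold>\<or> x = x"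
  using zero_least by (simp add: le_iff_join)

lemma le_refl [simp]: "x \<in> carrier M \<Longrightarrow> x \<^bold>\<le> x"
  by (simp add: le_iff_join join_idem)

lemma le_antisym: "\<lbrakk>x \<^bold>\<le> y; y \<^bold>\<le> x; x \<in> carrier M; y \<in> carrier M\<rbrakk> \<Longrightarrow> x = y"
  by (metis join_comm le_iff_join)

lemma le_trans [trans]:
  "\<lbrakk>x \<^bold>\<le> y; y \<^bold>\<le> z; x \<in> carrier M; y \<in> carrier M; z \<in> carrier M\<rbrakk> \<Longrightarrow> x \<^bold>\<le> z"
  by (metis join_assoc le_iff_join)

lemma join_ge1 [simp]: "\<lbrakk>x \<in> carrier M; y \<in> carrier M\<rbrakk> \<Longrightarrow> x \<^bold>\<le> x \<^bold>\<or> y"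
  by (metis join_assoc join_idem le_iff_join)

lemma join_ge2 [simp]: "\<lbrakk>x \<in> carrier M; y \<in> carrier M\<rbrakk> \<Longrightarrow> y \<^bold>\<le> x \<^bold>\<or> y"
  by (metis join_comm join_ge1)

lemma join_least:
  "\<lbrakk>x \<^bold>\<le> z; y \<^bold>\<le> z; x \<in> carrier M; y \<in> carrier M; z \<in> carrier M\<rbrakk> \<Longrightarrow> x \<^bold>\<or> y \<^bold>\<le> z"
  by (simp add: join_assoc le_iff_join)

lemma le_iff_meet: "\<lbrakk>x \<in> carrier M; y \<in> carrier M\<rbrakk> \<Longrightarrow> x \<^bold>\<le> y \<longleftrightarrow> x \<^bold>\<and> y = x"
  by (metis join_comm join_meet_absorb le_iff_join meet_comm meet_join_absorb)

lemma meet_le1 [simp]: "\<lbrakk>x \<in> carrier M; y \<in> carrier M\<rbrakk> \<Longrightarrow> x \<^bold>\<and> y \<^bold>\<le> x"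
  by (metis join_comm join_meet_absorb le_iff_join meet_closed)

lemma meet_le2 [simp]: "\<lbrakk>x \<in> carrier M; y \<in> carrier M\<rbrakk> \<Longrightarrow> x \<^bold>\<and> y \<^bold>\<le> y"
  by (metis meet_comm meet_le1)

lemma meet_greatest:
  "\<lbrakk>z \<^bold>\<le> x; z \<^bold>\<le> y; x \<in> carrier M; y \<in> carrier M; z \<in> carrier M\<rbrakk> \<Longrightarrow> z \<^bold>\<le> x \<^bold>\<and> y"
  by (metis le_iff_meet meet_assoc meet_closed)

lemma meet_meet_distrib:
  "\<lbrakk>x \<in> carrier M; y \<in> carrier M; z \<in> carrier M\<rbrakk> \<Longrightarrow> (x \<^bold>\<and> y) \<^bold>\<and> (x \<^bold>\<and> z) = x \<^bold>\<and> (y \<^bold>\<and> z)"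
  by (metis le_iff_meet le_refl meet_assoc meet_closed meet_comm)

lemma le_zero: "\<lbrakk>x \<^bold>\<le> \<^bold>\<zero>; x \<in> carrier M\<rbrakk> \<Longrightarrow> x = \<^bold>\<zero>"
  by (simp add: le_antisym zero_least)

declare zero_least [simp]

lemma mem_segment: "x \<in> emv_segment M a \<longleftrightarrow> x \<in> carrier M \<and> x \<^bold>\<le> a"
  by (auto simp: at_least_at_most_def emv_order_def)

lemma carrier_emv_order [simp]: "carrier (emv_order M) = carrier M"
  by (simp add: emv_order_def)

end

text \<open>The left adjoint of \<open>w \<mapsto> y \<oplus> w\<close>. The defining property
  quantifies over all of \<open>M\<close>, so the value cannot depend on a bounding
  idempotent.\<close>

definition emv_minus :: "('a, 'm) emv_scheme \<Rightarrow> 'a \<Rightarrow> 'a \<Rightarrow> 'a"  (infixl \<open>\<^bold>\<ominus>\<index>\<close> 65) where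
  "x \<^bold>\<ominus>\<^bsub>M\<^esub> y = (THE z. z \<in> carrier M \<and> (\<forall>w \<in> carrier M. z \<^bold>\<le>\<^bsub>M\<^esub> w \<longleftrightarrow> x \<^bold>\<le>\<^bsub>M\<^esub> y \<^bold>\<oplus>\<^bsub>M\<^esub> w))"

section \<open>Relative complements and residuals\<close>

context emv_algebra
begin

lemma plus_closed [simp]: "\<lbrakk>x \<in> carrier M; y \<in> carrier M\<rbrakk> \<Longrightarrow> x \<^bold>\<oplus> y \<in> carrier M"
  using comm_monoid.axioms(1)[OF plus_comm_monoid] monoid.m_closed by fastforce

lemma plus_assoc:
  "\<lbrakk>x \<in> carrier M; y \<in> carrier M; z \<in> carrier M\<rbrakk> \<Longrightarrow> (x \<^bold>\<oplus> y) \<^bold>\<oplus> z = x \<^bold>\<oplus> (y \<^bold>\<oplus> z)"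
  using comm_monoid.axioms(1)[OF plus_comm_monoid] monoid.m_assoc by fastforce

lemma plus_comm: "\<lbrakk>x \<in> carrier M; y \<in> carrier M\<rbrakk> \<Longrightarrow> x \<^bold>\<oplus> y = y \<^bold>\<oplus> x"
  using comm_monoid.m_comm[OF plus_comm_monoid] by simp

lemma plus_left_comm:
  "\<lbrakk>x \<in> carrier M; y \<in> carrier M; z \<in> carrier M\<rbrakk> \<Longrightarrow> x \<^bold>\<oplus> (y \<^bold>\<oplus> z) = y \<^bold>\<oplus> (x \<^bold>\<oplus> z)"
  by (metis plus_assoc plus_comm)

lemmas plus_ac = plus_assoc plus_comm plus_left_comm

lemma zero_plus [simp]: "x \<in> carrier M \<Longrightarrow> \<^bold>\<zero> \<^bold>\<oplus> x = x"
  using comm_monoid.axioms(1)[OF plus_comm_monoid] monoid.l_one by fastforce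

lemma plus_zero [simp]: "x \<in> carrier M \<Longrightarrow> x \<^bold>\<oplus> \<^bold>\<zero> = x"
  by (metis plus_comm zero_closed zero_plus)

lemma plus_mono2:
  "\<lbrakk>x \<^bold>\<le> x'; y \<^bold>\<le> y'; x \<in> carrier M; x' \<in> carrier M; y \<in> carrier M; y' \<in> carrier M\<rbrakk>
   \<Longrightarrow> x \<^bold>\<oplus> y \<^bold>\<le> x' \<^bold>\<oplus> y'"
  using le_trans[of "x \<^bold>\<oplus> y" "x' \<^bold>\<oplus> y" "x' \<^bold>\<oplus> y'"] plus_mono[of x x' y] plus_mono[of y y' x']
  by (simp add: plus_comm[of x' y] plus_comm[of x' y'])

lemma plus_ge1 [simp]: "\<lbrakk>x \<in> carrier M; y \<in> carrier M\<rbrakk> \<Longrightarrow> x \<^bold>\<le> x \<^bold>\<oplus> y"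
  using plus_mono2[of x x "\<^bold>\<zero>" y] by simp

lemma plus_ge2 [simp]: "\<lbrakk>x \<in> carrier M; y \<in> carrier M\<rbrakk> \<Longrightarrow> y \<^bold>\<le> x \<^bold>\<oplus> y"
  by (simp add: plus_comm[of x])

lemma idem_closed: "a \<in> emv_idem M \<Longrightarrow> a \<in> carrier M"
  and idem_plus: "a \<in> emv_idem M \<Longrightarrow> a \<^bold>\<oplus> a = a"
  by (auto simp: emv_idem_def)

lemma plus_le_idem:
  "\<lbrakk>a \<in> emv_idem M; x \<^bold>\<le> a; y \<^bold>\<le> a; x \<in> carrier M; y \<in> carrier M\<rbrakk> \<Longrightarrow> x \<^bold>\<oplus> y \<^bold>\<le> a"
  by (metis idem_closed idem_plus plus_mono2)

lemma is_lam_unique: "\<lbrakk>emv_is_lam M a x l; emv_is_lam M a x l'\<rbrakk> \<Longrightarrow> l = l'"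
  unfolding emv_is_lam_def least_def by (auto simp: mem_segment intro!: le_antisym)

lemma is_lam_lam:
  assumes "a \<in> emv_idem M" "x \<in> carrier M" "x \<^bold>\<le> a"
  shows "emv_is_lam M a x (emv_lam M a x)"
proof -
  obtain l where "emv_is_lam M a x l"
    using lam_exists assms mem_segment by blast
  then show ?thesis
    unfolding emv_lam_def by (rule theI) (blast intro: is_lam_unique \<open>emv_is_lam M a x l\<close>)
qed

lemma lam_closed:
  assumes "a \<in> emv_idem M" "x \<in> carrier M" "x \<^bold>\<le> a"
  shows "emv_lam M a x \<in> carrier M" "emv_lam M a x \<^bold>\<le> a"
  using is_lam_lam[OF assms] by (auto simp: emv_is_lam_def least_def mem_segment)

lemma lam_lam:
  assumes "a \<in> emv_idem M" "x \<in> carrier M" "x \<^bold>\<le> a"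
  shows "emv_lam M a (emv_lam M a x) = x"
  using mv_algebra.neg_neg[OF segment_mv] assms mem_segment by blast

text \<open>The order that the MV-algebra \<open>[0,a]\<close> carries intrinsically is the order of \<open>M\<close>.\<close>

lemma le_iff_lam:
  assumes a: "a \<in> emv_idem M" and x: "x \<in> carrier M" "x \<^bold>\<le> a" and y: "y \<in> carrier M" "y \<^bold>\<le> a"
  shows "x \<^bold>\<le> y \<longleftrightarrow> emv_lam M a x \<^bold>\<oplus> y = a"
proof
  note l = lam_closed[OF a x]
  assume le: "x \<^bold>\<le> y"
  have "x \<^bold>\<oplus> emv_lam M a x = a"
    using is_lam_lam[OF a x] by (auto simp: emv_is_lam_def least_def)
  then have "a \<^bold>\<le> emv_lam M a x \<^bold>\<oplus> y"
    by (metis le l(1) le_refl plus_comm plus_mono2 x(1) y(1))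
  then show "emv_lam M a x \<^bold>\<oplus> y = a"
    by (simp add: a idem_closed l le_antisym plus_le_idem y)
next
  assume "emv_lam M a x \<^bold>\<oplus> y = a"
  moreover have "emv_is_lam M a (emv_lam M a x) x"
    using is_lam_lam[OF a lam_closed[OF a x]] lam_lam[OF a x] by simp
  ultimately show "x \<^bold>\<le> y"
    using y by (auto simp: emv_is_lam_def least_def mem_segment)
qed

text \<open>By \<open>le_iff_lam\<close> both inequalities become the same equation
  \<open>\<lambda>\<^sub>a x \<oplus> y \<oplus> w = a\<close>.\<close>

lemma segment_residual:
  assumes a: "a \<in> emv_idem M" and x: "x \<in> carrier M" "x \<^bold>\<le> a" and y: "y \<in> carrier M" "y \<^bold>\<le> a"
    and w: "w \<in> carrier M" "w \<^bold>\<le> a"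
  shows "emv_lam M a (emv_lam M a x \<^bold>\<oplus> y) \<^bold>\<le> w \<longleftrightarrow> x \<^bold>\<le> y \<^bold>\<oplus> w"
proof -
  note lx = lam_closed[OF a x]
  have xy: "emv_lam M a x \<^bold>\<oplus> y \<in> carrier M" "emv_lam M a x \<^bold>\<oplus> y \<^bold>\<le> a"
    by (simp_all add: a lx plus_le_idem y)
  have "emv_lam M a (emv_lam M a x \<^bold>\<oplus> y) \<^bold>\<le> w \<longleftrightarrow> (emv_lam M a x \<^bold>\<oplus> y) \<^bold>\<oplus> w = a"
    using le_iff_lam[OF a lam_closed[OF a xy] w] lam_lam[OF a xy] by simp
  also have "\<dots> \<longleftrightarrow> x \<^bold>\<le> y \<^bold>\<oplus> w"
    using le_iff_lam[OF a x, of "y \<^bold>\<oplus> w"] by (simp add: plus_assoc lx y w plus_le_idem a)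
  finally show ?thesis .
qed

lemma idem_above2:
  assumes "x \<in> carrier M" "y \<in> carrier M"
  obtains a where "a \<in> emv_idem M" "x \<^bold>\<le> a" "y \<^bold>\<le> a"
proof -
  obtain a where a: "a \<in> emv_idem M" "x \<^bold>\<or> y \<^bold>\<le> a"
    using idem_cofinal assms join_closed by blast
  show thesis
    using a assms idem_closed by (intro that[of a]) (auto intro: le_trans[of _ "x \<^bold>\<or> y"])
qed

lemma idem_above3:
  assumes "x \<in> carrier M" "y \<in> carrier M" "z \<in> carrier M"
  obtains a where "a \<in> emv_idem M" "x \<^bold>\<le> a" "y \<^bold>\<le> a" "z \<^bold>\<le> a"
proof -
  obtain a where a: "a \<in> emv_idem M" "x \<^bold>\<or> y \<^bold>\<le> a" "z \<^bold>\<le> a"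
    using idem_above2[of "x \<^bold>\<or> y" z] assms by auto
  show thesis
    using a assms idem_closed by (intro that[of a]) (auto intro: le_trans[of _ "x \<^bold>\<or> y"])
qed

text \<open>Inside a segment \<open>x \<oplus> _\<close> is a right adjoint, so it preserves meets:
  the residual \<open>m\<close> of the right-hand side by \<open>x\<close> lies below
  \<open>y\<close> and below \<open>z\<close>, hence below their meet.\<close>

lemma plus_meet_distrib:
  assumes [simp]: "x \<in> carrier M" "y \<in> carrier M" "z \<in> carrier M"
  shows "x \<^bold>\<oplus> (y \<^bold>\<and> z) = (x \<^bold>\<oplus> y) \<^bold>\<and> (x \<^bold>\<oplus> z)"
proof (rule le_antisym)
  show "x \<^bold>\<oplus> (y \<^bold>\<and> z) \<^bold>\<le> (x \<^bold>\<oplus> y) \<^bold>\<and> (x \<^bold>\<oplus> z)"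
    by (simp add: meet_greatest plus_mono2)
  obtain a where a: "a \<in> emv_idem M" "x \<^bold>\<le> a" "y \<^bold>\<le> a" "z \<^bold>\<le> a"
    using idem_above3[of x y z] by auto
  note [simp] = idem_closed[OF a(1)]
  define w where "w = (x \<^bold>\<oplus> y) \<^bold>\<and> (x \<^bold>\<oplus> z)"
  have w[simp]: "w \<in> carrier M" "w \<^bold>\<le> x \<^bold>\<oplus> y" "w \<^bold>\<le> x \<^bold>\<oplus> z" by (auto simp: w_def)
  have wa: "w \<^bold>\<le> a"
    by (rule le_trans[OF w(2) plus_le_idem]) (auto simp: a)
  have yz: "y \<^bold>\<and> z \<^bold>\<le> a" by (rule le_trans[of _ y]) (auto simp: a)
  define m where "m = emv_lam M a (emv_lam M a w \<^bold>\<oplus> x)"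
  have m: "m \<in> carrier M"
    unfolding m_def by (intro lam_closed a plus_closed plus_le_idem) (auto simp: a wa lam_closed)
  note res = segment_residual[OF a(1) w(1) wa assms(1) a(2), folded m_def]
  have "m \<^bold>\<le> y \<^bold>\<and> z"
    using res[of y] res[of z] a m by (auto intro: meet_greatest)
  then show "(x \<^bold>\<oplus> y) \<^bold>\<and> (x \<^bold>\<oplus> z) \<^bold>\<le> x \<^bold>\<oplus> (y \<^bold>\<and> z)"
    using res[of "y \<^bold>\<and> z"] yz by (simp add: w_def)
qed auto

text \<open>The bound \<open>w \<le> a\<close> of \<open>segment_residual\<close> is removed by
  testing against \<open>w \<and> a\<close>; distributivity splits off the condition
  \<open>x \<le> y \<oplus> a\<close>, which always holds.\<close>

lemma residual:
  assumes a: "a \<in> emv_idem M" and x: "x \<in> carrier M" "x \<^bold>\<le> a" and y: "y \<in> carrier M" "y \<^bold>\<le> a"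
    and w: "w \<in> carrier M"
  shows "emv_lam M a (emv_lam M a x \<^bold>\<oplus> y) \<^bold>\<le> w \<longleftrightarrow> x \<^bold>\<le> y \<^bold>\<oplus> w"
proof -
  note [simp] = idem_closed[OF a] x y w
  define m where "m = emv_lam M a (emv_lam M a x \<^bold>\<oplus> y)"
  have m: "m \<in> carrier M" "m \<^bold>\<le> a"
    unfolding m_def by (intro lam_closed a plus_closed plus_le_idem; simp add: a lam_closed)+
  have "m \<^bold>\<le> w \<longleftrightarrow> m \<^bold>\<le> w \<^bold>\<and> a"
    by (metis assms(6) idem_closed[OF a] le_trans m meet_closed meet_greatest meet_le1)
  also have "\<dots> \<longleftrightarrow> x \<^bold>\<le> y \<^bold>\<oplus> (w \<^bold>\<and> a)"
    unfolding m_def by (rule segment_residual[OF a x y]) auto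
  also have "\<dots> \<longleftrightarrow> x \<^bold>\<le> (y \<^bold>\<oplus> w) \<^bold>\<and> (y \<^bold>\<oplus> a)"
    by (simp add: plus_meet_distrib)
  also have "\<dots> \<longleftrightarrow> x \<^bold>\<le> y \<^bold>\<oplus> w"
  proof -
    have "x \<^bold>\<le> y \<^bold>\<oplus> a" by (rule le_trans[of _ a]) auto
    then show ?thesis
      using le_trans[of x "(y \<^bold>\<oplus> w) \<^bold>\<and> (y \<^bold>\<oplus> a)" "y \<^bold>\<oplus> w"] meet_greatest[of x "y \<^bold>\<oplus> w" "y \<^bold>\<oplus> a"] by auto
  qed
  finally show ?thesis unfolding m_def .
qed

lemma minus_unique:
  assumes "x \<in> carrier M" "y \<in> carrier M" "m \<in> carrier M"
    and "\<And>w. w \<in> carrier M \<Longrightarrow> m \<^bold>\<le> w \<longleftrightarrow> x \<^bold>\<le> y \<^bold>\<oplus> w"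
  shows "x \<^bold>\<ominus> y = m"
  unfolding emv_minus_def
proof (rule the_equality)
  fix z assume z: "z \<in> carrier M \<and> (\<forall>w\<in>carrier M. z \<^bold>\<le> w \<longleftrightarrow> x \<^bold>\<le> y \<^bold>\<oplus> w)"
  with assms have "\<forall>w\<in>carrier M. z \<^bold>\<le> w \<longleftrightarrow> m \<^bold>\<le> w" by simp
  then show "z = m"
    using z assms(3) le_refl le_antisym by blast
qed (use assms in simp)

lemma minus_eq_lam:
  assumes a: "a \<in> emv_idem M" and x: "x \<in> carrier M" "x \<^bold>\<le> a" and y: "y \<in> carrier M" "y \<^bold>\<le> a"
  shows "x \<^bold>\<ominus> y = emv_lam M a (emv_lam M a x \<^bold>\<oplus> y)"
proof (rule minus_unique[OF x(1) y(1)])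
  show "emv_lam M a (emv_lam M a x \<^bold>\<oplus> y) \<in> carrier M"
    by (intro lam_closed a plus_closed plus_le_idem; simp add: a x y lam_closed)
qed (rule residual[OF assms])

lemma minus_closed [simp]:
  assumes "x \<in> carrier M" "y \<in> carrier M"
  shows "x \<^bold>\<ominus> y \<in> carrier M"
proof -
  obtain a where a: "a \<in> emv_idem M" "x \<^bold>\<le> a" "y \<^bold>\<le> a" using idem_above2 assms .
  show ?thesis
    using minus_eq_lam[of a x y] a assms by (simp add: lam_closed plus_le_idem)
qed

lemma minus_le_iff:
  assumes "x \<in> carrier M" "y \<in> carrier M" "z \<in> carrier M"
  shows "x \<^bold>\<ominus> y \<^bold>\<le> z \<longleftrightarrow> x \<^bold>\<le> y \<^bold>\<oplus> z"
proof -
  obtain a where a: "a \<in> emv_idem M" "x \<^bold>\<le> a" "y \<^bold>\<le> a" using idem_above2 assms(1,2) .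
  show ?thesis
    using minus_eq_lam[of a x y] residual[of a x y z] a assms by simp
qed

lemma lam_top: "a \<in> emv_idem M \<Longrightarrow> emv_lam M a a = \<^bold>\<zero>"
  by (metis idem_closed lam_lam mv_algebra.neg_zero segment_mv zero_closed zero_least)

lemma lam_eq_minus:
  assumes a: "a \<in> emv_idem M" and x: "x \<in> carrier M" "x \<^bold>\<le> a"
  shows "emv_lam M a x = a \<^bold>\<ominus> x"
  using minus_eq_lam[OF a idem_closed[OF a] _ x] by (simp add: lam_top a idem_closed x)

lemma minus_minus_idem:
  assumes "a \<in> emv_idem M" "x \<in> carrier M" "x \<^bold>\<le> a"
  shows "a \<^bold>\<ominus> (a \<^bold>\<ominus> x) = x"
  using lam_lam[OF assms] lam_eq_minus assms lam_closed by metis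

text \<open>The Lukasiewicz axiom for \<open>x\<close> and \<open>y\<close>: since
  \<open>y \<le> x\<close>, its left side collapses to \<open>x\<close>, and its right side is
  \<open>y \<oplus> (x \<ominus> y)\<close>.\<close>

lemma plus_minus:
  assumes y: "y \<in> carrier M" and x: "x \<in> carrier M" and le: "y \<^bold>\<le> x"
  shows "y \<^bold>\<oplus> (x \<^bold>\<ominus> y) = x"
proof -
  obtain a where a: "a \<in> emv_idem M" "x \<^bold>\<le> a" using idem_cofinal x by blast
  have ya: "y \<^bold>\<le> a" using le_trans a x y le idem_closed by blast
  interpret mv_algebra "emv_segment M a" "(\<^bold>\<oplus>)" "emv_lam M a" "\<^bold>\<zero>" a
    by (rule segment_mv[OF a(1)])
  have "x \<^bold>\<oplus> emv_lam M a (x \<^bold>\<oplus> emv_lam M a y) = x"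
    using le_iff_lam[OF a(1) y ya x a(2)] le lam_closed[OF a(1) y ya] x
    by (simp add: plus_comm[of x "emv_lam M a y"] lam_top a)
  moreover have "x \<^bold>\<ominus> y = emv_lam M a (y \<^bold>\<oplus> emv_lam M a x)"
    using minus_eq_lam[OF a(1) x a(2) y ya] lam_closed[OF a(1) x a(2)] y by (simp add: plus_comm)
  ultimately show ?thesis
    using lukasiewicz[of x y] x y ya a by (simp add: mem_segment)
qed

section \<open>Arithmetic of the truncated difference\<close>

lemma minus_le [simp]: "\<lbrakk>x \<in> carrier M; y \<in> carrier M\<rbrakk> \<Longrightarrow> x \<^bold>\<ominus> y \<^bold>\<le> x"
  by (simp add: minus_le_iff)

lemma le_plus_minus: "\<lbrakk>x \<in> carrier M; y \<in> carrier M\<rbrakk> \<Longrightarrow> x \<^bold>\<le> y \<^bold>\<oplus> (x \<^bold>\<ominus> y)"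
  by (metis le_refl minus_closed minus_le_iff)

lemma minus_plus:
  assumes [simp]: "x \<in> carrier M" "y \<in> carrier M" "z \<in> carrier M"
  shows "x \<^bold>\<ominus> (y \<^bold>\<oplus> z) = x \<^bold>\<ominus> y \<^bold>\<ominus> z"
  by (rule minus_unique) (auto simp: minus_le_iff plus_assoc)

lemma minus_zero [simp]: "x \<in> carrier M \<Longrightarrow> x \<^bold>\<ominus> \<^bold>\<zero> = x"
  by (rule minus_unique) auto

lemma minus_eq_zero_iff: "\<lbrakk>x \<in> carrier M; y \<in> carrier M\<rbrakk> \<Longrightarrow> x \<^bold>\<ominus> y = \<^bold>\<zero> \<longleftrightarrow> x \<^bold>\<le> y"
  by (metis le_refl le_zero minus_closed minus_le_iff plus_zero zero_closed)

lemma minus_mono: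
  assumes [simp]: "x \<in> carrier M" "x' \<in> carrier M" "y \<in> carrier M" "y' \<in> carrier M"
    and "x \<^bold>\<le> x'" "y' \<^bold>\<le> y"
  shows "x \<^bold>\<ominus> y \<^bold>\<le> x' \<^bold>\<ominus> y'"
proof -
  have "x \<^bold>\<le> x'" by fact
  also have "x' \<^bold>\<le> y' \<^bold>\<oplus> (x' \<^bold>\<ominus> y')" by (simp add: le_plus_minus)
  also have "y' \<^bold>\<oplus> (x' \<^bold>\<ominus> y') \<^bold>\<le> y \<^bold>\<oplus> (x' \<^bold>\<ominus> y')" using assms by (simp add: plus_mono)
  finally show ?thesis by (simp add: minus_le_iff)
qed

lemma le_minus_swap:
  assumes a: "a \<in> emv_idem M" and x: "x \<in> carrier M" "x \<^bold>\<le> a" and y: "y \<in> carrier M" "y \<^bold>\<le> a"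
    and le: "x \<^bold>\<le> a \<^bold>\<ominus> y"
  shows "y \<^bold>\<le> a \<^bold>\<ominus> x"
  using minus_mono[of a a "a \<^bold>\<ominus> y" x] minus_minus_idem[OF a y] x y le idem_closed[OF a] by simp

lemma minus_swap_le:
  assumes a: "a \<in> emv_idem M" and x: "x \<in> carrier M" "x \<^bold>\<le> a" and y: "y \<in> carrier M" "y \<^bold>\<le> a"
    and le: "a \<^bold>\<ominus> y \<^bold>\<le> x"
  shows "a \<^bold>\<ominus> x \<^bold>\<le> y"
  using minus_mono[of a a x "a \<^bold>\<ominus> y"] minus_minus_idem[OF a y] x y le idem_closed[OF a] by simp

text \<open>The hypothesis \<open>x \<le> a \<ominus> y\<close> says that
  \<open>x \<oplus> y\<close> does not overflow \<open>a\<close>. Taking complements in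
  \<open>[0,a]\<close> turns the cancellation into \<open>plus_minus\<close> for
  \<open>y \<le> a \<ominus> x\<close>.\<close>

lemma plus_minus_cancel:
  assumes a: "a \<in> emv_idem M" and x: "x \<in> carrier M" "x \<^bold>\<le> a" and y: "y \<in> carrier M" "y \<^bold>\<le> a"
    and le: "x \<^bold>\<le> a \<^bold>\<ominus> y"
  shows "(x \<^bold>\<oplus> y) \<^bold>\<ominus> y = x"
proof -
  note [simp] = idem_closed[OF a] x y
  have xy: "x \<^bold>\<oplus> y \<^bold>\<le> a" by (simp add: a plus_le_idem)
  have "(x \<^bold>\<oplus> y) \<^bold>\<ominus> y = (a \<^bold>\<ominus> (a \<^bold>\<ominus> (x \<^bold>\<oplus> y))) \<^bold>\<ominus> y"
    using minus_minus_idem[OF a _ xy] by simp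
  also have "\<dots> = a \<^bold>\<ominus> (y \<^bold>\<oplus> (a \<^bold>\<ominus> x \<^bold>\<ominus> y))"
    by (simp add: minus_plus[symmetric] plus_comm)
  also have "y \<^bold>\<oplus> (a \<^bold>\<ominus> x \<^bold>\<ominus> y) = a \<^bold>\<ominus> x"
    using le_minus_swap[OF assms] by (simp add: plus_minus)
  finally show ?thesis by (simp add: minus_minus_idem a)
qed

text \<open>Only the smaller sum has to stay free of overflow; \<open>z\<close> is unrestricted. The
  later proofs use cancellation in this form.\<close>

lemma plus_le_cancel:
  assumes a: "a \<in> emv_idem M" and x: "x \<in> carrier M" "x \<^bold>\<le> a" and y: "y \<in> carrier M" "y \<^bold>\<le> a"
    and z: "z \<in> carrier M"
    and le: "x \<^bold>\<le> a \<^bold>\<ominus> y" and le2: "x \<^bold>\<oplus> y \<^bold>\<le> z \<^bold>\<oplus> y"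
  shows "x \<^bold>\<le> z"
  using plus_minus_cancel[OF a x y le] le2 minus_le_iff[of "x \<^bold>\<oplus> y" y z] x y z
  by (simp add: plus_comm[of z y])

section \<open>Idempotents as direct factors\<close>

lemma idem_meet_plus:
  assumes a: "a \<in> emv_idem M" and [simp]: "x \<in> carrier M" "y \<in> carrier M"
  shows "a \<^bold>\<and> (x \<^bold>\<oplus> y) = (a \<^bold>\<and> x) \<^bold>\<oplus> (a \<^bold>\<and> y)"
proof (rule le_antisym)
  note [simp] = idem_closed[OF a]
  show "(a \<^bold>\<and> x) \<^bold>\<oplus> (a \<^bold>\<and> y) \<^bold>\<le> a \<^bold>\<and> (x \<^bold>\<oplus> y)"
    by (intro meet_greatest plus_le_idem[OF a] plus_mono2) auto
  define w where "w = a \<^bold>\<and> (x \<^bold>\<oplus> y)"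
  have [simp]: "w \<in> carrier M" and wa: "w \<^bold>\<le> a" and w2: "w \<^bold>\<le> x \<^bold>\<oplus> y" by (auto simp: w_def)
  \<comment> \<open>Expanding the sum of the two meets by \<open>plus_meet_distrib\<close> yields
    \<open>x \<oplus> y\<close> and terms with a summand \<open>a\<close>; the latter lie above
    \<open>w\<close> in any case.\<close>
  have w3: "w \<^bold>\<le> a \<^bold>\<oplus> z" "w \<^bold>\<le> z \<^bold>\<oplus> a" if "z \<in> carrier M" for z
    using that wa le_trans[of w a "a \<^bold>\<oplus> z"] by (auto simp: plus_comm[of z])
  have "w \<^bold>\<le> (a \<^bold>\<and> x) \<^bold>\<oplus> y"
    using w2 w3 by (simp add: plus_comm[of "a \<^bold>\<and> x" y] plus_meet_distrib meet_greatest plus_comm[of y x])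
  moreover have "w \<^bold>\<le> (a \<^bold>\<and> x) \<^bold>\<oplus> a" by (simp add: w3)
  ultimately show "a \<^bold>\<and> (x \<^bold>\<oplus> y) \<^bold>\<le> (a \<^bold>\<and> x) \<^bold>\<oplus> (a \<^bold>\<and> y)"
    by (simp add: plus_meet_distrib meet_greatest w_def)
qed (simp_all add: idem_closed[OF a])

text \<open>An element \<open>z\<close> below both \<open>a\<close> and \<open>b \<ominus> a\<close>
  satisfies \<open>z \<oplus> a \<le> a\<close>, and cancelling \<open>a\<close> gives
  \<open>z = 0\<close>. The join follows by applying this to the complement of
  \<open>a \<or> (b \<ominus> a)\<close>. A sum \<open>v \<oplus> v\<close> with
  \<open>v = b \<ominus> a\<close> has no component in \<open>a\<close>, so it stays below
  \<open>v\<close>.\<close>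

lemma
  assumes a: "a \<in> emv_idem M" and b: "b \<in> emv_idem M" and ab: "a \<^bold>\<le> b"
  shows idem_meet_compl: "a \<^bold>\<and> (b \<^bold>\<ominus> a) = \<^bold>\<zero>"
    and idem_join_compl: "a \<^bold>\<or> (b \<^bold>\<ominus> a) = b"
    and compl_idem: "b \<^bold>\<ominus> a \<in> emv_idem M"
proof -
  note [simp] = idem_closed[OF a] idem_closed[OF b] ab
  have disj: "z = \<^bold>\<zero>" if z[simp]: "z \<in> carrier M" "z \<^bold>\<le> a" "z \<^bold>\<le> b \<^bold>\<ominus> a" for z
  proof -
    have "z \<^bold>\<oplus> a \<^bold>\<le> a" by (simp add: a plus_le_idem)
    moreover have "z \<^bold>\<le> b" by (rule le_trans[of _ a]) auto
    ultimately show ?thesis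
      using plus_le_cancel[OF b z(1) _ _ ab zero_closed z(3)] by (simp add: le_zero)
  qed
  show 1: "a \<^bold>\<and> (b \<^bold>\<ominus> a) = \<^bold>\<zero>" by (rule disj) auto
  define w where "w = a \<^bold>\<or> (b \<^bold>\<ominus> a)"
  have w[simp]: "w \<in> carrier M" "w \<^bold>\<le> b" "a \<^bold>\<le> w" "b \<^bold>\<ominus> a \<^bold>\<le> w" by (auto simp: w_def intro: join_least)
  have "b \<^bold>\<ominus> w = \<^bold>\<zero>"
    using minus_mono[of b b w a] minus_mono[of b b w "b \<^bold>\<ominus> a"]
    by (intro disj) (auto simp: minus_minus_idem b)
  then show 2: "a \<^bold>\<or> (b \<^bold>\<ominus> a) = b"
    using minus_minus_idem[OF b w(1,2)] by (simp add: w_def)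
  let ?v = "b \<^bold>\<ominus> a"
  have v: "?v \<in> carrier M" "?v \<^bold>\<le> b" by auto
  have "?v \<^bold>\<oplus> ?v = (?v \<^bold>\<oplus> ?v) \<^bold>\<and> (a \<^bold>\<or> ?v)"
    by (metis 2 b le_iff_meet plus_closed plus_le_idem v idem_closed)
  also have "\<dots> = (a \<^bold>\<and> (?v \<^bold>\<oplus> ?v)) \<^bold>\<or> (?v \<^bold>\<and> (?v \<^bold>\<oplus> ?v))"
    using meet_join_distrib[of "?v \<^bold>\<oplus> ?v" a ?v] by (simp add: meet_comm[of _ "?v \<^bold>\<oplus> ?v"])
  also have "a \<^bold>\<and> (?v \<^bold>\<oplus> ?v) = \<^bold>\<zero>"
    by (simp add: idem_meet_plus a 1)
  also have "?v \<^bold>\<and> (?v \<^bold>\<oplus> ?v) = ?v"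
    using le_iff_meet[of ?v "?v \<^bold>\<oplus> ?v"] by simp
  also have "\<^bold>\<zero> \<^bold>\<or> ?v = ?v"
    using le_iff_join zero_least v by blast
  finally show "?v \<in> emv_idem M" by (simp add: emv_idem_def)
qed

text \<open>The component of \<open>a \<oplus> (x \<ominus> a)\<close> in
  \<open>b \<ominus> a\<close> comes from \<open>x \<ominus> a\<close> alone. So subtracting an
  idempotent is a projection, and the right-hand side does not depend on the chosen
  \<open>b\<close>.\<close>

lemma minus_idem_eq_meet:
  assumes a: "a \<in> emv_idem M" and b: "b \<in> emv_idem M" and ab: "a \<^bold>\<le> b"
    and x: "x \<in> carrier M" "x \<^bold>\<le> b"
  shows "x \<^bold>\<ominus> a = x \<^bold>\<and> (b \<^bold>\<ominus> a)"
proof (rule le_antisym)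
  note [simp] = idem_closed[OF a] idem_closed[OF b] ab x
  show "x \<^bold>\<ominus> a \<^bold>\<le> x \<^bold>\<and> (b \<^bold>\<ominus> a)"
    by (intro meet_greatest minus_mono) auto
  let ?v = "b \<^bold>\<ominus> a"
  have v: "?v \<in> emv_idem M" by (rule compl_idem[OF a b ab])
  have "x \<^bold>\<and> ?v \<^bold>\<le> ?v \<^bold>\<and> (a \<^bold>\<oplus> (x \<^bold>\<ominus> a))"
    using le_trans[of "x \<^bold>\<and> ?v" x "a \<^bold>\<oplus> (x \<^bold>\<ominus> a)"] by (intro meet_greatest) (auto simp: le_plus_minus)
  also have "\<dots> = ?v \<^bold>\<and> (x \<^bold>\<ominus> a)"
  proof -
    have "?v \<^bold>\<and> a = \<^bold>\<zero>" using idem_meet_compl[OF a b ab] by (simp add: meet_comm[of a ?v])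
    then show ?thesis using idem_meet_plus[OF v, of a "x \<^bold>\<ominus> a"] by simp
  qed
  also have "\<dots> \<^bold>\<le> x \<^bold>\<ominus> a" by simp
  finally show "x \<^bold>\<and> ?v \<^bold>\<le> x \<^bold>\<ominus> a" by simp
qed (simp_all add: idem_closed a b x)

section \<open>The product through truncated differences\<close>

lemma odot_indep:
  assumes a: "a \<in> emv_idem M" and b: "b \<in> emv_idem M" and ab: "a \<^bold>\<le> b"
    and x: "x \<in> carrier M" "x \<^bold>\<le> a" and y: "y \<in> carrier M" "y \<^bold>\<le> a"
  shows "x \<^bold>\<ominus> (a \<^bold>\<ominus> y) = x \<^bold>\<ominus> (b \<^bold>\<ominus> y)"
proof (rule le_antisym)
  note [simp] = idem_closed[OF a] idem_closed[OF b] ab x y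
  show "x \<^bold>\<ominus> (b \<^bold>\<ominus> y) \<^bold>\<le> x \<^bold>\<ominus> (a \<^bold>\<ominus> y)"
    by (intro minus_mono) auto
  define z where "z = x \<^bold>\<ominus> (b \<^bold>\<ominus> y)"
  have [simp]: "z \<in> carrier M" "z \<^bold>\<le> a"
    by (auto simp: z_def intro: le_trans[of _ x])
  \<comment> \<open>Enlarging the segment from \<open>a\<close> to \<open>b\<close> increases the
    complement of \<open>y\<close> by at most \<open>b \<ominus> a\<close>; this excess is disjoint
    from \<open>a\<close> and disappears under the meet with \<open>a\<close>.\<close>
  have "b \<^bold>\<le> y \<^bold>\<oplus> ((a \<^bold>\<ominus> y) \<^bold>\<oplus> (b \<^bold>\<ominus> a))"
    by (metis ab idem_closed[OF a] idem_closed[OF b] le_refl minus_closed plus_assoc plus_minus y)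
  then have 1: "b \<^bold>\<ominus> y \<^bold>\<le> (a \<^bold>\<ominus> y) \<^bold>\<oplus> (b \<^bold>\<ominus> a)"
    by (simp add: minus_le_iff)
  have "x \<^bold>\<le> (b \<^bold>\<ominus> y) \<^bold>\<oplus> z"
    by (simp add: z_def le_plus_minus)
  also have "\<dots> \<^bold>\<le> (a \<^bold>\<ominus> y) \<^bold>\<oplus> (b \<^bold>\<ominus> a) \<^bold>\<oplus> z"
    using 1 by (simp add: plus_mono)
  finally have "x \<^bold>\<le> a \<^bold>\<and> ((a \<^bold>\<ominus> y) \<^bold>\<oplus> (b \<^bold>\<ominus> a) \<^bold>\<oplus> z)"
    by (simp add: meet_greatest)
  also have "\<dots> = (a \<^bold>\<ominus> y) \<^bold>\<oplus> z"
    using le_iff_meet[of "a \<^bold>\<ominus> y" a] le_iff_meet[of z a] idem_meet_compl[OF a b ab]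
    by (simp add: idem_meet_plus[OF a] meet_comm[of a z] meet_comm[of a "a \<^bold>\<ominus> y"])
  finally show "x \<^bold>\<ominus> (a \<^bold>\<ominus> y) \<^bold>\<le> x \<^bold>\<ominus> (b \<^bold>\<ominus> y)"
    by (simp add: minus_le_iff z_def)
qed (simp_all add: idem_closed a b x y)

lemma odot_eq:
  assumes a: "a \<in> emv_idem M" and x: "x \<in> carrier M" "x \<^bold>\<le> a" and y: "y \<in> carrier M" "y \<^bold>\<le> a"
  shows "emv_odot M x y = x \<^bold>\<ominus> (a \<^bold>\<ominus> y)"
proof -
  let ?P = "\<lambda>a. a \<in> emv_idem M \<and> x \<^bold>\<le> a \<and> y \<^bold>\<le> a"
  define b where "b = (SOME a. ?P a)"
  have b: "b \<in> emv_idem M" "x \<^bold>\<le> b" "y \<^bold>\<le> b"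
    using someI[of ?P a] assms unfolding b_def by auto
  \<comment> \<open>The idempotent selected by \<open>SOME\<close> and the given \<open>a\<close>
    may be incomparable; both are compared with a common upper bound.\<close>
  obtain d where d: "d \<in> emv_idem M" "a \<^bold>\<le> d" "b \<^bold>\<le> d"
    using idem_above2[of a b] idem_closed a b by metis
  have "emv_odot M x y = x \<^bold>\<ominus> (b \<^bold>\<ominus> y)"
    unfolding emv_odot_def b_def[symmetric] Let_def
    using minus_eq_lam[OF b(1) x(1) b(2), of "b \<^bold>\<ominus> y"] b x y lam_eq_minus[OF b(1) y(1) b(3)]
    by (simp add: idem_closed)
  also have "\<dots> = x \<^bold>\<ominus> (a \<^bold>\<ominus> y)"
    using odot_indep[OF b(1) d(1,3) x(1) b(2) y(1) b(3)] odot_indep[OF a d(1,2) x y] by simp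
  finally show ?thesis .
qed

text \<open>This form contains only \<open>\<oplus>\<close> and \<open>\<lambda>\<^sub>a\<close>,
  which segments and isomorphisms preserve.\<close>

lemma odot_eq_lam:
  assumes a: "a \<in> emv_idem M" and x: "x \<in> carrier M" "x \<^bold>\<le> a" and y: "y \<in> carrier M" "y \<^bold>\<le> a"
  shows "emv_odot M x y = emv_lam M a (emv_lam M a x \<^bold>\<oplus> emv_lam M a y)"
  using odot_eq[OF assms] minus_eq_lam[OF a x lam_closed[OF a y]] lam_eq_minus[OF a y] by simp

end

section \<open>The unital group of a midpoint lattice\<close>

text \<open>In a 2-divisible unital group \<open>mid x y\<close> is \<open>(x + y)/2\<close> on \<open>[0,u]\<close> and \<open>ng x\<close> is \<open>u - x\<close>.\<close>

locale midpoint_lattice =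
  fixes A :: "'a set" and le :: "'a \<Rightarrow> 'a \<Rightarrow> bool"  (infix \<open>\<preceq>\<close> 50)
    and jn mt mid :: "'a \<Rightarrow> 'a \<Rightarrow> 'a" and ng :: "'a \<Rightarrow> 'a" and bt tp :: 'a
  assumes ml_refl [simp]: "x \<in> A \<Longrightarrow> x \<preceq> x"
    and ml_antisym: "\<lbrakk>x \<preceq> y; y \<preceq> x; x \<in> A; y \<in> A\<rbrakk> \<Longrightarrow> x = y"
    and ml_trans: "\<lbrakk>x \<preceq> y; y \<preceq> z; x \<in> A; y \<in> A; z \<in> A\<rbrakk> \<Longrightarrow> x \<preceq> z"
    and jn_closed [simp]: "\<lbrakk>x \<in> A; y \<in> A\<rbrakk> \<Longrightarrow> jn x y \<in> A"
    and jn_ge1 [simp]: "\<lbrakk>x \<in> A; y \<in> A\<rbrakk> \<Longrightarrow> x \<preceq> jn x y"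
    and jn_ge2 [simp]: "\<lbrakk>x \<in> A; y \<in> A\<rbrakk> \<Longrightarrow> y \<preceq> jn x y"
    and jn_least: "\<lbrakk>x \<preceq> z; y \<preceq> z; x \<in> A; y \<in> A; z \<in> A\<rbrakk> \<Longrightarrow> jn x y \<preceq> z"
    and mt_closed [simp]: "\<lbrakk>x \<in> A; y \<in> A\<rbrakk> \<Longrightarrow> mt x y \<in> A"
    and mt_le1 [simp]: "\<lbrakk>x \<in> A; y \<in> A\<rbrakk> \<Longrightarrow> mt x y \<preceq> x"
    and mt_le2 [simp]: "\<lbrakk>x \<in> A; y \<in> A\<rbrakk> \<Longrightarrow> mt x y \<preceq> y"
    and mt_greatest: "\<lbrakk>z \<preceq> x; z \<preceq> y; x \<in> A; y \<in> A; z \<in> A\<rbrakk> \<Longrightarrow> z \<preceq> mt x y"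
    and bt_closed [simp]: "bt \<in> A" and bt_least [simp]: "x \<in> A \<Longrightarrow> bt \<preceq> x"
    and tp_closed [simp]: "tp \<in> A" and tp_greatest [simp]: "x \<in> A \<Longrightarrow> x \<preceq> tp"
    and mid_closed [simp]: "\<lbrakk>x \<in> A; y \<in> A\<rbrakk> \<Longrightarrow> mid x y \<in> A"
    and mid_comm: "\<lbrakk>x \<in> A; y \<in> A\<rbrakk> \<Longrightarrow> mid x y = mid y x"
    and mid_idem [simp]: "x \<in> A \<Longrightarrow> mid x x = x"
    and mid_medial: "\<lbrakk>x \<in> A; y \<in> A; z \<in> A; w \<in> A\<rbrakk> \<Longrightarrow> mid (mid x y) (mid z w) = mid (mid x z) (mid y w)"
    and mid_le_iff [simp]: "\<lbrakk>x \<in> A; y \<in> A; z \<in> A\<rbrakk> \<Longrightarrow> mid x z \<preceq> mid y z \<longleftrightarrow> x \<preceq> y"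
    and mid_convex: "\<lbrakk>z \<in> A; p \<in> A; mid bt p \<preceq> z; z \<preceq> mid tp p\<rbrakk> \<Longrightarrow> \<exists>x \<in> A. z = mid x p"
    and ng_closed [simp]: "x \<in> A \<Longrightarrow> ng x \<in> A"
    and mid_ng: "x \<in> A \<Longrightarrow> mid x (ng x) = mid bt tp"
begin

text \<open>The element \<open>u/2\<close>. It is fixed by \<open>emb\<close> and represents the
  neutral element at every stage, since \<open>2(u/2) - u = 0\<close>.\<close>

definition "ctr = mid bt tp"

definition "emb x = mid x ctr"

lemma emb_eq: "x \<in> A \<Longrightarrow> emb x = mid x ctr"
  by (simp add: emb_def)

lemma ctr_closed [simp]: "ctr \<in> A"
  by (simp add: ctr_def)

lemma mid_eq_iff: "\<lbrakk>x \<in> A; y \<in> A; z \<in> A\<rbrakk> \<Longrightarrow> mid x z = mid y z \<longleftrightarrow> x = y"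
  by (metis mid_le_iff ml_antisym ml_refl)

lemma embn_closed [simp]: "x \<in> A \<Longrightarrow> (emb ^^ n) x \<in> A"
  by (induction n) (auto simp: emb_eq)

lemma embn_le_iff [simp]: "\<lbrakk>x \<in> A; y \<in> A\<rbrakk> \<Longrightarrow> (emb ^^ n) x \<preceq> (emb ^^ n) y \<longleftrightarrow> x \<preceq> y"
  by (induction n) (auto simp: emb_eq)

lemma embn_eq_iff [simp]: "\<lbrakk>x \<in> A; y \<in> A\<rbrakk> \<Longrightarrow> (emb ^^ n) x = (emb ^^ n) y \<longleftrightarrow> x = y"
  by (metis embn_le_iff ml_antisym ml_refl)

lemma embn_embn: "(emb ^^ m) ((emb ^^ n) x) = (emb ^^ (m + n)) x"
  by (simp add: funpow_add)

text \<open>Mediality with \<open>ctr = mid ctr ctr\<close>. The transition maps thus respect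
  midpoints, which makes addition in the limit independent of the stage.\<close>

lemma embn_mid: "\<lbrakk>x \<in> A; y \<in> A\<rbrakk> \<Longrightarrow> (emb ^^ n) (mid x y) = mid ((emb ^^ n) x) ((emb ^^ n) y)"
proof (induction n)
  case (Suc n)
  then show ?case
    using mid_medial[of "(emb ^^ n) x" "(emb ^^ n) y" ctr ctr] by (simp add: emb_eq)
qed simp

lemma embn_ctr [simp]: "(emb ^^ n) ctr = ctr"
  by (induction n) (auto simp: emb_eq)

text \<open>\<open>mid_convex\<close> makes the image of \<open>mid _ p\<close> a full interval, and
  iteration keeps this for \<open>emb\<close>. Hence a late-stage element within the stage-0 bounds
  already comes from stage 0.\<close>

lemma embn_convex:
  "\<lbrakk>z \<in> A; (emb ^^ n) bt \<preceq> z; z \<preceq> (emb ^^ n) tp\<rbrakk> \<Longrightarrow> \<exists>x \<in> A. z = (emb ^^ n) x"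
proof (induction n arbitrary: z)
  case (Suc n)
  have "mid bt ctr \<preceq> z" "z \<preceq> mid tp ctr"
    using Suc.prems ml_trans[of "mid bt ctr" "(emb ^^ Suc n) bt" z]
      ml_trans[of z "(emb ^^ Suc n) tp" "mid tp ctr"] by (simp_all add: emb_eq)
  then obtain w where w: "w \<in> A" "z = emb w"
    using mid_convex[of z ctr] Suc.prems by (auto simp: emb_eq)
  then have "(emb ^^ n) bt \<preceq> w" "w \<preceq> (emb ^^ n) tp"
    using Suc.prems by (auto simp: emb_eq)
  then show ?case
    using Suc.IH[OF w(1)] w by auto
qed auto

text \<open>By convexity the join of the two images is itself of the form \<open>mid v p\<close>,
  and reflection of the order puts \<open>v\<close> above \<open>x\<close> and \<open>y\<close>. The
  statement for meets is dual.\<close>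

lemma mid_jn:
  assumes [simp]: "x \<in> A" "y \<in> A" "p \<in> A"
  shows "mid (jn x y) p = jn (mid x p) (mid y p)"
proof (rule ml_antisym)
  let ?w = "jn (mid x p) (mid y p)"
  have "mid bt p \<preceq> ?w"
    by (rule ml_trans[of _ "mid x p"]) auto
  moreover have "?w \<preceq> mid tp p" by (simp add: jn_least)
  ultimately obtain v where v: "v \<in> A" "?w = mid v p"
    using mid_convex[of ?w p] by auto
  then have "x \<preceq> v" "y \<preceq> v"
    using jn_ge1[of "mid x p" "mid y p"] jn_ge2[of "mid x p" "mid y p"] by auto
  then show "mid (jn x y) p \<preceq> ?w"
    using v by (simp add: jn_least)
qed (auto simp: jn_least)

lemma mid_mt:
  assumes [simp]: "x \<in> A" "y \<in> A" "p \<in> A"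
  shows "mid (mt x y) p = mt (mid x p) (mid y p)"
proof (rule ml_antisym)
  let ?w = "mt (mid x p) (mid y p)"
  have "?w \<preceq> mid tp p"
    by (rule ml_trans[of _ "mid x p"]) auto
  moreover have "mid bt p \<preceq> ?w" by (simp add: mt_greatest)
  ultimately obtain v where v: "v \<in> A" "?w = mid v p"
    using mid_convex[of ?w p] by auto
  then have "v \<preceq> x" "v \<preceq> y"
    using mt_le1[of "mid x p" "mid y p"] mt_le2[of "mid x p" "mid y p"] by auto
  then show "?w \<preceq> mid (mt x y) p"
    using v by (simp add: mt_greatest)
qed (auto simp: mt_greatest)

lemma embn_jn: "\<lbrakk>x \<in> A; y \<in> A\<rbrakk> \<Longrightarrow> (emb ^^ n) (jn x y) = jn ((emb ^^ n) x) ((emb ^^ n) y)"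
  by (induction n) (auto simp: emb_eq mid_jn)

lemma embn_mt: "\<lbrakk>x \<in> A; y \<in> A\<rbrakk> \<Longrightarrow> (emb ^^ n) (mt x y) = mt ((emb ^^ n) x) ((emb ^^ n) y)"
  by (induction n) (auto simp: emb_eq mid_mt)

text \<open>\<open>cls n x\<close> stands for \<open>2\<^sup>n(2x - u)\<close>. Since \<open>emb x = x/2 + u/4\<close>, the pairs \<open>(n, x)\<close> and
  \<open>(n + 1, emb x)\<close> denote the same group element, and the sum of \<open>(n, x)\<close> and \<open>(n, y)\<close> is
  \<open>(n + 1, mid x y)\<close>.\<close>

definition cls :: "nat \<Rightarrow> 'a \<Rightarrow> (nat \<times> 'a) set" where
  "cls n x = {(m, y). y \<in> A \<and> (emb ^^ m) x = (emb ^^ n) y}"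

text \<open>Sum and order are read off representatives at a common stage, which always exist
  (\<open>carrier2\<close>); \<open>mult_cls\<close> justifies the \<open>THE\<close>.\<close>

definition midpoint_group :: "'a unital_lgroup_over" where
  "midpoint_group =
    \<lparr>carrier = {cls n x |n x. x \<in> A},
     mult = (\<lambda>P Q. THE R. \<exists>n. \<exists>x\<in>A. \<exists>y\<in>A. P = cls n x \<and> Q = cls n y \<and> R = cls (Suc n) (mid x y)),
     one = cls 0 ctr,
     lg_le = (\<lambda>P Q. \<exists>n. \<exists>x\<in>A. \<exists>y\<in>A. P = cls n x \<and> Q = cls n y \<and> x \<preceq> y)\<rparr>"

abbreviation "G \<equiv> midpoint_group"

text \<open>Two pairs are identified when their lifts to stage \<open>n + m\<close> agree.
  Transitivity is cross-lifting followed by injectivity of \<open>emb\<close>.\<close>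

lemma cls_eq_iff:
  assumes [simp]: "x \<in> A" "y \<in> A"
  shows "cls n x = cls m y \<longleftrightarrow> (emb ^^ m) x = (emb ^^ n) y"
proof
  assume "cls n x = cls m y"
  moreover have "(n, x) \<in> cls n x" by (simp add: cls_def)
  ultimately show "(emb ^^ m) x = (emb ^^ n) y" by (simp add: cls_def)
next
  assume eq: "(emb ^^ m) x = (emb ^^ n) y"
  have "(emb ^^ k) x = (emb ^^ n) z \<longleftrightarrow> (emb ^^ k) y = (emb ^^ m) z" if [simp]: "z \<in> A" for k z
  proof -
    have "(emb ^^ k) x = (emb ^^ n) z \<longleftrightarrow> (emb ^^ m) ((emb ^^ k) x) = (emb ^^ m) ((emb ^^ n) z)"
      by simp
    also have "(emb ^^ m) ((emb ^^ k) x) = (emb ^^ n) ((emb ^^ k) y)"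
      by (metis add.commute embn_embn eq)
    also have "(emb ^^ m) ((emb ^^ n) z) = (emb ^^ n) ((emb ^^ m) z)"
      by (metis add.commute embn_embn)
    finally show ?thesis by simp
  qed
  then show "cls n x = cls m y" by (auto simp: cls_def)
qed

section \<open>Representatives and the group operation\<close>

lemma cls_lift: "x \<in> A \<Longrightarrow> cls n x = cls (k + n) ((emb ^^ k) x)"
  by (simp add: cls_eq_iff embn_embn add.commute)

lemma cls_eq_same [simp]: "\<lbrakk>x \<in> A; y \<in> A\<rbrakk> \<Longrightarrow> cls n x = cls n y \<longleftrightarrow> x = y"
  by (simp add: cls_eq_iff)

lemma cls_ctr: "cls n ctr = cls 0 ctr"
  by (simp add: cls_eq_iff)

lemma cls_closed [simp]: "x \<in> A \<Longrightarrow> cls n x \<in> carrier G"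
  by (auto simp: midpoint_group_def)

text \<open>Once represented at stage \<open>n\<close>, an element is represented at every later
  stage; several elements can therefore be moved to one stage.\<close>

lemma carrier_lift:
  assumes "P \<in> carrier G"
  shows "\<exists>n. \<forall>k. \<exists>x \<in> A. P = cls (k + n) x"
proof -
  obtain n x where "x \<in> A" "P = cls n x" using assms by (auto simp: midpoint_group_def)
  then show ?thesis using cls_lift embn_closed by metis
qed

lemma carrier3:
  assumes "P \<in> carrier G" "Q \<in> carrier G" "R \<in> carrier G"
  obtains n x y z where "x \<in> A" "y \<in> A" "z \<in> A" "P = cls n x" "Q = cls n y" "R = cls n z"
proof -
  obtain l where l: "\<forall>k. \<exists>x \<in> A. P = cls (k + l) x" using carrier_lift[OF assms(1)] ..
  obtain m where m: "\<forall>k. \<exists>x \<in> A. Q = cls (k + m) x" using carrier_lift[OF assms(2)] ..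
  obtain n where n: "\<forall>k. \<exists>x \<in> A. R = cls (k + n) x" using carrier_lift[OF assms(3)] ..
  show thesis
    using that[of _ _ _ "l + m + n"] l[rule_format, of "m + n"] m[rule_format, of "l + n"]
      n[rule_format, of "l + m"]
    by (metis add.assoc add.commute)
qed

lemma carrier2:
  assumes "P \<in> carrier G" "Q \<in> carrier G"
  obtains n x y where "x \<in> A" "y \<in> A" "P = cls n x" "Q = cls n y"
  using carrier3[OF assms assms(2)] by metis

lemma mult_cls:
  assumes [simp]: "x \<in> A" "y \<in> A"
  shows "cls n x \<otimes>\<^bsub>G\<^esub> cls n y = cls (Suc n) (mid x y)"
proof -
  have "cls n x \<otimes>\<^bsub>G\<^esub> cls n y =
    (THE R. \<exists>m. \<exists>x'\<in>A. \<exists>y'\<in>A. cls n x = cls m x' \<and> cls n y = cls m y' \<and> R = cls (Suc m) (mid x' y'))"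
    by (simp add: midpoint_group_def)
  also have "\<dots> = cls (Suc n) (mid x y)"
  proof (rule the_equality)
    fix R
    assume "\<exists>m. \<exists>x'\<in>A. \<exists>y'\<in>A. cls n x = cls m x' \<and> cls n y = cls m y' \<and> R = cls (Suc m) (mid x' y')"
    then obtain m x' y' where [simp]: "x' \<in> A" "y' \<in> A"
      and "cls n x = cls m x'" "cls n y = cls m y'" and R: "R = cls (Suc m) (mid x' y')" by blast
    then have "(emb ^^ m) x = (emb ^^ n) x'" "(emb ^^ m) y = (emb ^^ n) y'"
      by (simp_all add: cls_eq_iff)
    then show "R = cls (Suc n) (mid x y)"
      by (simp add: R cls_eq_iff embn_mid)
  qed (use assms in blast)
  finally show ?thesis .
qed

lemma le_cls:
  assumes [simp]: "x \<in> A" "y \<in> A"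
  shows "lg_le G (cls n x) (cls n y) \<longleftrightarrow> x \<preceq> y"
proof
  assume "lg_le G (cls n x) (cls n y)"
  then obtain m x' y' where [simp]: "x' \<in> A" "y' \<in> A"
      and "cls n x = cls m x'" "cls n y = cls m y'" and le: "x' \<preceq> y'"
    by (auto simp: midpoint_group_def)
  then have "(emb ^^ m) x = (emb ^^ n) x'" "(emb ^^ m) y = (emb ^^ n) y'"
    by (simp_all add: cls_eq_iff)
  with le have "(emb ^^ m) x \<preceq> (emb ^^ m) y" by simp
  then show "x \<preceq> y" by simp
next
  assume "x \<preceq> y"
  then have "\<exists>m. \<exists>x'\<in>A. \<exists>y'\<in>A. cls n x = cls m x' \<and> cls n y = cls m y' \<and> x' \<preceq> y'"
    using assms by blast
  then show "lg_le G (cls n x) (cls n y)" by (simp add: midpoint_group_def)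
qed

lemma one_cls: "\<one>\<^bsub>G\<^esub> = cls n ctr"
  by (simp add: midpoint_group_def cls_ctr[of n])

lemma mult_closed [simp]: "\<lbrakk>P \<in> carrier G; Q \<in> carrier G\<rbrakk> \<Longrightarrow> P \<otimes>\<^bsub>G\<^esub> Q \<in> carrier G"
  by (erule (1) carrier2) (simp add: mult_cls)

text \<open>Associativity is mediality: the third summand \<open>z\<close> is lifted to
  \<open>mid z ctr\<close>, and the medial law exchanges \<open>y\<close> and
  \<open>ctr\<close>.\<close>

lemma comm_group_midpoint_group: "comm_group G"
proof (rule comm_groupI)
  fix P Q R assume "P \<in> carrier G" "Q \<in> carrier G" "R \<in> carrier G"
  then obtain n x y z where [simp]: "x \<in> A" "y \<in> A" "z \<in> A"
    and [simp]: "P = cls n x" "Q = cls n y" "R = cls n z" by (rule carrier3)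
  have lift: "cls n w = cls (Suc n) (emb w)" if "w \<in> A" for w
    using cls_lift[OF that, of n 1] by simp
  have [simp]: "emb w \<in> A" if "w \<in> A" for w
    using that by (simp add: emb_eq)
  have "P \<otimes>\<^bsub>G\<^esub> Q \<otimes>\<^bsub>G\<^esub> R = cls (Suc (Suc n)) (mid (mid x y) (emb z))"
    using lift[of z] by (simp add: mult_cls)
  also have "mid (mid x y) (emb z) = mid (emb x) (mid y z)"
    using mid_medial[of x y ctr z] by (simp add: emb_eq mid_comm[of z ctr])
  also have "cls (Suc (Suc n)) \<dots> = P \<otimes>\<^bsub>G\<^esub> (Q \<otimes>\<^bsub>G\<^esub> R)"
    using lift[of x] by (simp add: mult_cls)
  finally show "P \<otimes>\<^bsub>G\<^esub> Q \<otimes>\<^bsub>G\<^esub> R = P \<otimes>\<^bsub>G\<^esub> (Q \<otimes>\<^bsub>G\<^esub> R)" .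
next
  fix P Q assume "P \<in> carrier G" "Q \<in> carrier G"
  then obtain n x y where [simp]: "x \<in> A" "y \<in> A" "P = cls n x" "Q = cls n y" by (rule carrier2)
  show "P \<otimes>\<^bsub>G\<^esub> Q = Q \<otimes>\<^bsub>G\<^esub> P" by (simp add: mult_cls mid_comm)
next
  fix P assume "P \<in> carrier G"
  then obtain n x where [simp]: "x \<in> A" "P = cls n x" by (metis carrier2)
  have "cls (Suc n) (mid ctr x) = cls n x"
    using cls_lift[of x n 1] by (simp add: emb_eq mid_comm[of ctr x])
  then show "\<one>\<^bsub>G\<^esub> \<otimes>\<^bsub>G\<^esub> P = P" by (simp add: one_cls[of n] mult_cls)
  show "\<exists>Q\<in>carrier G. Q \<otimes>\<^bsub>G\<^esub> P = \<one>\<^bsub>G\<^esub>"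
    \<comment> \<open>\<open>ng x\<close> is \<open>u - x\<close>, and \<open>2(u - x) - u\<close>
      is the negative of \<open>2x - u\<close>.\<close>
    by (rule bexI[of _ "cls n (ng x)"])
       (simp_all add: mult_cls mid_comm[of "ng x" x] mid_ng one_cls[of "Suc n"] flip: ctr_def)
qed (auto simp: one_cls[of 0])

section \<open>The lattice order of the limit\<close>

lemma partial_order_midpoint_group: "partial_order (lg_order G)"
proof
  fix P Q R assume "P \<in> carrier (lg_order G)" "Q \<in> carrier (lg_order G)" "R \<in> carrier (lg_order G)"
  then have "P \<in> carrier G" "Q \<in> carrier G" "R \<in> carrier G" by (simp_all add: lg_order_def)
  then obtain n x y z where [simp]: "x \<in> A" "y \<in> A" "z \<in> A"
    and [simp]: "P = cls n x" "Q = cls n y" "R = cls n z" by (rule carrier3)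
  assume "P \<sqsubseteq>\<^bsub>lg_order G\<^esub> Q"
  then show "Q \<sqsubseteq>\<^bsub>lg_order G\<^esub> R \<Longrightarrow> P \<sqsubseteq>\<^bsub>lg_order G\<^esub> R"
    using ml_trans[of x y z] by (simp add: lg_order_def le_cls)
next
  fix P Q assume "P \<in> carrier (lg_order G)" "Q \<in> carrier (lg_order G)"
  then have "P \<in> carrier G" "Q \<in> carrier G" by (simp_all add: lg_order_def)
  then obtain n x y where [simp]: "x \<in> A" "y \<in> A" "P = cls n x" "Q = cls n y" by (rule carrier2)
  assume "P \<sqsubseteq>\<^bsub>lg_order G\<^esub> Q" "Q \<sqsubseteq>\<^bsub>lg_order G\<^esub> P"
  then show "P .=\<^bsub>lg_order G\<^esub> Q"
    using ml_antisym[of x y] by (simp add: lg_order_def le_cls)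
next
  fix P assume "P \<in> carrier (lg_order G)"
  then have "P \<in> carrier G" by (simp add: lg_order_def)
  then obtain n x where "x \<in> A" "P = cls n x" by (metis carrier2)
  then show "P \<sqsubseteq>\<^bsub>lg_order G\<^esub> P" by (simp add: lg_order_def le_cls)
qed (auto simp: lg_order_def)

text \<open>A competing upper bound may live only at a later stage, so \<open>x\<close> and
  \<open>y\<close> are lifted to it; this is harmless because \<open>emb\<close> preserves
  joins.\<close>

lemma least_Upper_cls:
  assumes [simp]: "x \<in> A" "y \<in> A"
  shows "least (lg_order G) (cls n (jn x y)) (Upper (lg_order G) {cls n x, cls n y})"
proof -
  interpret partial_order "lg_order G" by (rule partial_order_midpoint_group)
  show ?thesis
  proof (rule least_UpperI)
    fix P assume "P \<in> Upper (lg_order G) {cls n x, cls n y}"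
    then have P: "P \<in> carrier G" "lg_le G (cls n x) P" "lg_le G (cls n y) P"
      by (auto simp: Upper_def lg_order_def)
    obtain m where "\<forall>k. \<exists>z \<in> A. P = cls (k + m) z" using carrier_lift[OF P(1)] ..
    then obtain z where [simp]: "z \<in> A" and z: "P = cls (m + n) z" by (metis add.commute)
    have "(emb ^^ m) x \<preceq> z" "(emb ^^ m) y \<preceq> z"
      using P(2,3) cls_lift[of x n m] cls_lift[of y n m] by (simp_all add: z le_cls)
    then show "cls n (jn x y) \<sqsubseteq>\<^bsub>lg_order G\<^esub> P"
      using cls_lift[of "jn x y" n m] by (simp add: z lg_order_def le_cls embn_jn jn_least)
  qed (auto simp: lg_order_def le_cls)
qed

lemma greatest_Lower_cls:
  assumes [simp]: "x \<in> A" "y \<in> A"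
  shows "greatest (lg_order G) (cls n (mt x y)) (Lower (lg_order G) {cls n x, cls n y})"
proof -
  interpret partial_order "lg_order G" by (rule partial_order_midpoint_group)
  show ?thesis
  proof (rule greatest_LowerI)
    fix P assume "P \<in> Lower (lg_order G) {cls n x, cls n y}"
    then have P: "P \<in> carrier G" "lg_le G P (cls n x)" "lg_le G P (cls n y)"
      by (auto simp: Lower_def lg_order_def)
    obtain m where "\<forall>k. \<exists>z \<in> A. P = cls (k + m) z" using carrier_lift[OF P(1)] ..
    then obtain z where [simp]: "z \<in> A" and z: "P = cls (m + n) z" by (metis add.commute)
    have "z \<preceq> (emb ^^ m) x" "z \<preceq> (emb ^^ m) y"
      using P(2,3) cls_lift[of x n m] cls_lift[of y n m] by (simp_all add: z le_cls)
    then show "P \<sqsubseteq>\<^bsub>lg_order G\<^esub> cls n (mt x y)"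
      using cls_lift[of "mt x y" n m] by (simp add: z lg_order_def le_cls embn_mt mt_greatest)
  qed (auto simp: lg_order_def le_cls)
qed

lemma lattice_midpoint_group: "lattice (lg_order G)"
proof -
  interpret partial_order "lg_order G" by (rule partial_order_midpoint_group)
  show ?thesis
  proof
    fix P Q assume "P \<in> carrier (lg_order G)" "Q \<in> carrier (lg_order G)"
    then have "P \<in> carrier G" "Q \<in> carrier G" by (simp_all add: lg_order_def)
    then obtain n x y where "x \<in> A" "y \<in> A" "P = cls n x" "Q = cls n y" by (rule carrier2)
    then show "\<exists>s. least (lg_order G) s (Upper (lg_order G) {P, Q})"
      using least_Upper_cls by auto
  next
    fix P Q assume "P \<in> carrier (lg_order G)" "Q \<in> carrier (lg_order G)"
    then have "P \<in> carrier G" "Q \<in> carrier G" by (simp_all add: lg_order_def)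
    then obtain n x y where "x \<in> A" "y \<in> A" "P = cls n x" "Q = cls n y" by (rule carrier2)
    then show "\<exists>s. greatest (lg_order G) s (Lower (lg_order G) {P, Q})"
      using greatest_Lower_cls by auto
  qed
qed

lemma join_cls: "\<lbrakk>x \<in> A; y \<in> A\<rbrakk> \<Longrightarrow> cls n x \<squnion>\<^bsub>lg_order G\<^esub> cls n y = cls n (jn x y)"
proof -
  interpret partial_order "lg_order G" by (rule partial_order_midpoint_group)
  assume "x \<in> A" "y \<in> A"
  then show ?thesis
    unfolding join_def sup_def using least_Upper_cls least_unique by (metis someI)
qed

lemma meet_cls: "\<lbrakk>x \<in> A; y \<in> A\<rbrakk> \<Longrightarrow> cls n x \<sqinter>\<^bsub>lg_order G\<^esub> cls n y = cls n (mt x y)"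
proof -
  interpret partial_order "lg_order G" by (rule partial_order_midpoint_group)
  assume "x \<in> A" "y \<in> A"
  then show ?thesis
    unfolding meet_def inf_def using greatest_Lower_cls greatest_unique by (metis someI)
qed

text \<open>The multiple \<open>2\<^sup>n u\<close> is the top of stage \<open>n\<close>. Every
  element of that stage lies below it, so \<open>u\<close> is a strong unit.\<close>

lemma unit_power: "cls 0 tp [^]\<^bsub>G\<^esub> (2 ^ n :: nat) = cls n tp"
proof (induction n)
  case (Suc n)
  interpret comm_group G by (rule comm_group_midpoint_group)
  have "cls 0 tp [^]\<^bsub>G\<^esub> (2 ^ Suc n :: nat) = cls n tp \<otimes>\<^bsub>G\<^esub> cls n tp"
    by (simp add: mult_2 Suc nat_pow_mult[symmetric])
  then show ?case by (simp add: mult_cls)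
next
  case 0
  interpret comm_group G by (rule comm_group_midpoint_group)
  show ?case by simp
qed

lemma abelian_unital_lgroup_midpoint_group: "abelian_unital_lgroup G (cls 0 tp)"
proof -
  interpret comm_group G by (rule comm_group_midpoint_group)
  show ?thesis
  proof (intro abelian_unital_lgroup.intro abelian_lgroup.intro abelian_unital_lgroup_axioms.intro
      abelian_lgroup_axioms.intro)
    fix P Q R assume "P \<in> carrier G" "Q \<in> carrier G" "R \<in> carrier G"
    then obtain n x y z where "x \<in> A" "y \<in> A" "z \<in> A" "P = cls n x" "Q = cls n y" "R = cls n z"
      by (rule carrier3)
    then show "lg_le G P Q \<Longrightarrow> lg_le G (P \<otimes>\<^bsub>G\<^esub> R) (Q \<otimes>\<^bsub>G\<^esub> R)"
      by (simp add: mult_cls le_cls)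
  next
    fix P assume "P \<in> carrier G"
    then obtain n x where "x \<in> A" "P = cls n x" by (metis carrier2)
    then show "\<exists>n::nat. lg_le G P (cls 0 tp [^]\<^bsub>G\<^esub> n)"
      by (metis le_cls tp_closed tp_greatest unit_power)
  qed (simp_all add: comm_group_midpoint_group lattice_midpoint_group one_cls[of 0] le_cls)
qed

text \<open>Since \<open>mid x x = x\<close>, doubling only raises the stage and halving lowers it.
  Uniqueness follows by comparing doubles at a common stage.\<close>

lemma has_half_cls:
  assumes [simp]: "x \<in> A"
  shows "lg_has_half G (cls (Suc n) x)" and "lg_half G (cls (Suc n) x) = cls n x"
proof -
  have uniq: "h = cls n x" if h: "h \<in> carrier G" "h \<otimes>\<^bsub>G\<^esub> h = cls (Suc n) x" for h
  proof -
    obtain m y z where [simp]: "y \<in> A" "z \<in> A" and e: "h = cls m y" "cls n x = cls m z"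
      by (rule carrier2[OF h(1) cls_closed[OF assms, of n]])
    have "cls (Suc m) y = h \<otimes>\<^bsub>G\<^esub> h" by (simp add: e(1) mult_cls)
    also have "\<dots> = cls n x \<otimes>\<^bsub>G\<^esub> cls n x" using h(2) by (simp add: mult_cls)
    also have "\<dots> = cls m z \<otimes>\<^bsub>G\<^esub> cls m z" by (simp only: e(2))
    also have "\<dots> = cls (Suc m) z" by (simp add: mult_cls)
    finally show ?thesis by (simp add: e)
  qed
  show "lg_has_half G (cls (Suc n) x)"
    unfolding lg_has_half_def
    by (rule ex1I[of _ "cls n x"]) (auto simp: mult_cls uniq)
  show "lg_half G (cls (Suc n) x) = cls n x"
    unfolding lg_half_def
    by (rule the_equality) (auto simp: mult_cls uniq)
qed

text \<open>An element \<open>a\<close> of the unit interval is \<open>2x - u\<close> for \<open>x = (a + u)/2\<close>.\<close>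

definition "iota a = cls 0 (mid a tp)"

lemma iota_closed_Gamma: "a \<in> A \<Longrightarrow> iota a \<in> carrier (mv_Gamma G (cls 0 tp))"
  by (auto simp: mv_Gamma_def iota_def at_least_at_most_def lg_order_def le_cls one_cls[of 0] ctr_def)

text \<open>For surjectivity, \<open>0 \<le> P \<le> u\<close> places a representative between the
  images of \<open>bt\<close> and \<open>tp\<close>, so it descends to some \<open>y\<close> at
  stage 0. There \<open>mid bt tp \<le> y \<le> mid tp tp\<close>, and convexity provides
  \<open>a\<close> with \<open>y = mid a tp\<close>.\<close>

lemma bij_betw_iota: "bij_betw iota A (carrier (mv_Gamma G (cls 0 tp)))"
  unfolding bij_betw_def
proof
  show "inj_on iota A" by (auto simp: inj_on_def iota_def mid_eq_iff)
  have "P \<in> iota ` A" if "P \<in> carrier (mv_Gamma G (cls 0 tp))" for P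
  proof -
    have P: "P \<in> carrier G" "lg_le G \<one>\<^bsub>G\<^esub> P" "lg_le G P (cls 0 tp)"
      using that by (auto simp: mv_Gamma_def at_least_at_most_def lg_order_def)
    then obtain n x where [simp]: "x \<in> A" "P = cls n x" by (metis carrier2)
    have x: "ctr \<preceq> x" "x \<preceq> (emb ^^ n) tp"
      using P(2,3) cls_lift[of tp 0 n] by (simp_all add: one_cls[of n] le_cls)
    moreover have "(emb ^^ n) bt \<preceq> x"
      using embn_le_iff[of bt ctr n] x(1) ml_trans[of "(emb ^^ n) bt" ctr x] by simp
    ultimately obtain y where y: "y \<in> A" "x = (emb ^^ n) y"
      using embn_convex[of x n] by auto
    have "(emb ^^ n) ctr \<preceq> (emb ^^ n) y" using x(1) y by simp
    then have "ctr \<preceq> y" using y by (simp del: embn_ctr)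
    then obtain a where a: "a \<in> A" "y = mid a tp"
      using mid_convex[of y tp] y by (auto simp: ctr_def)
    have "P = iota a"
      using a y by (simp add: iota_def cls_eq_iff)
    then show ?thesis using a by blast
  qed
  then show "iota ` A = carrier (mv_Gamma G (cls 0 tp))"
    using iota_closed_Gamma by auto
qed

text \<open>The hypothesis \<open>mid_pl\<close> is the truncated sum after halving:
  \<open>(x \<oplus> y)/2\<close> is the meet of \<open>(x + y)/2\<close> and
  \<open>u/2\<close>.\<close>

lemma iota_iso:
  fixes pl
  assumes pl: "\<And>x y. \<lbrakk>x \<in> A; y \<in> A\<rbrakk> \<Longrightarrow> pl x y \<in> A"
    and mid_pl: "\<And>x y. \<lbrakk>x \<in> A; y \<in> A\<rbrakk> \<Longrightarrow> mid (pl x y) bt = mt (mid x y) ctr"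
  shows "iota \<in> emv_iso \<lparr>carrier = A, emv_join = jn, emv_meet = mt, emv_plus = pl, emv_zero = bt\<rparr>
      (mv_Gamma G (cls 0 tp))"
proof -
  have "iota (pl x y) = (iota x \<otimes>\<^bsub>G\<^esub> iota y) \<sqinter>\<^bsub>lg_order G\<^esub> cls 0 tp" if [simp]: "x \<in> A" "y \<in> A" for x y
  proof -
    \<comment> \<open>The sum lives at stage 1, so the unit is lifted there before the meet is
      taken.\<close>
    have "iota x \<otimes>\<^bsub>G\<^esub> iota y = cls 1 (mid (mid x y) tp)"
      using mid_medial[of x tp y tp] by (simp add: iota_def mult_cls)
    moreover have "cls 0 tp = cls 1 (mid ctr tp)"
      using cls_lift[of tp 0 1] by (simp add: emb_eq mid_comm)
    ultimately have "(iota x \<otimes>\<^bsub>G\<^esub> iota y) \<sqinter>\<^bsub>lg_order G\<^esub> cls 0 tp = cls 1 (mid (mid (pl x y) bt) tp)"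
      by (simp add: meet_cls mid_mt mid_pl)
    also have "mid (mid (pl x y) bt) tp = emb (mid (pl x y) tp)"
      using mid_medial[of "pl x y" bt tp tp] by (simp add: emb_eq ctr_def pl)
    also have "cls 1 \<dots> = iota (pl x y)"
      using cls_lift[of "mid (pl x y) tp" 0 1] by (simp add: iota_def pl)
    finally show ?thesis by simp
  qed
  moreover have "iota bt = \<one>\<^bsub>G\<^esub>"
    by (simp add: iota_def one_cls[of 0] ctr_def)
  moreover have "iota (jn x y) = iota x \<squnion>\<^bsub>lg_order G\<^esub> iota y"
      "iota (mt x y) = iota x \<sqinter>\<^bsub>lg_order G\<^esub> iota y" if "x \<in> A" "y \<in> A" for x y
    using that by (simp_all add: iota_def join_cls meet_cls mid_jn mid_mt)
  ultimately show ?thesis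
    using bij_betw_iota by (simp add: emv_iso_def mv_Gamma_def)
qed

lemma half_iota:
  assumes [simp]: "a \<in> A"
  shows "lg_has_half G (iota a \<otimes>\<^bsub>G\<^esub> cls 0 tp)"
    and "lg_half G (iota a \<otimes>\<^bsub>G\<^esub> cls 0 tp) = iota (mid a tp)"
  by (simp_all add: iota_def mult_cls has_half_cls)

end

section \<open>Halving\<close>

text \<open>\<open>h x\<close> is \<open>x/2\<close> where that makes sense. Doubling alone does not
  determine it, because truncation can allow many solutions near the top; \<open>h_least\<close>
  selects the smallest.\<close>

locale emv_halving = emv_algebra M for M (structure) +
  fixes b :: 'a and h :: "'a \<Rightarrow> 'a"
  assumes top_idem: "b \<in> emv_idem M"
    and h_closed [simp]: "\<lbrakk>x \<in> carrier M; x \<^bold>\<le> b\<rbrakk> \<Longrightarrow> h x \<in> carrier M"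
    and h_double [simp]: "\<lbrakk>x \<in> carrier M; x \<^bold>\<le> b\<rbrakk> \<Longrightarrow> h x \<^bold>\<oplus> h x = x"
    and h_least: "\<lbrakk>x \<in> carrier M; x \<^bold>\<le> b; y \<in> carrier M; y \<^bold>\<le> b; x \<^bold>\<le> y \<^bold>\<oplus> y\<rbrakk> \<Longrightarrow> h x \<^bold>\<le> y"
begin

lemma top_closed [simp]: "b \<in> carrier M"
  by (simp add: idem_closed top_idem)

lemma top_plus_le [simp]: "\<lbrakk>x \<in> carrier M; y \<in> carrier M; x \<^bold>\<le> b; y \<^bold>\<le> b\<rbrakk> \<Longrightarrow> x \<^bold>\<oplus> y \<^bold>\<le> b"
  by (rule plus_le_idem[OF top_idem])

lemma h_le_self: "\<lbrakk>x \<in> carrier M; x \<^bold>\<le> b\<rbrakk> \<Longrightarrow> h x \<^bold>\<le> x"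
  by (rule h_least) auto

lemma h_le_top [simp]: "\<lbrakk>x \<in> carrier M; x \<^bold>\<le> b\<rbrakk> \<Longrightarrow> h x \<^bold>\<le> b"
  by (metis h_closed h_le_self le_trans top_closed)

lemma h_mono: "\<lbrakk>x \<in> carrier M; y \<in> carrier M; y \<^bold>\<le> b; x \<^bold>\<le> y\<rbrakk> \<Longrightarrow> h x \<^bold>\<le> h y"
  using le_trans[of x y b] by (simp add: h_least)

lemma h_zero [simp]: "h \<^bold>\<zero> = \<^bold>\<zero>"
  using h_le_self[of "\<^bold>\<zero>"] by (simp add: le_zero)

lemma h_plus_le:
  assumes [simp]: "x \<in> carrier M" "x \<^bold>\<le> b" "y \<in> carrier M" "y \<^bold>\<le> b"
  shows "h (x \<^bold>\<oplus> y) \<^bold>\<le> h x \<^bold>\<oplus> h y"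
proof (rule h_least)
  have "(h x \<^bold>\<oplus> h y) \<^bold>\<oplus> (h x \<^bold>\<oplus> h y) = (h x \<^bold>\<oplus> h x) \<^bold>\<oplus> (h y \<^bold>\<oplus> h y)"
    by (simp add: plus_ac del: h_double)
  then show "x \<^bold>\<oplus> y \<^bold>\<le> (h x \<^bold>\<oplus> h y) \<^bold>\<oplus> (h x \<^bold>\<oplus> h y)" by simp
qed auto

text \<open>For the nontrivial inequality, \<open>h (x \<oplus> y)\<close> is written as
  \<open>h y \<oplus> p\<close>. Doubling gives
  \<open>x \<oplus> y = (p \<oplus> p) \<oplus> y\<close>; the left sum does not overflow, so
  \<open>y\<close> cancels, and \<open>x \<le> p \<oplus> p\<close> yields
  \<open>h x \<le> p\<close>.\<close>

lemma h_plus: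
  assumes [simp]: "x \<in> carrier M" "x \<^bold>\<le> b" "y \<in> carrier M" "y \<^bold>\<le> b" and le: "x \<^bold>\<le> b \<^bold>\<ominus> y"
  shows "h (x \<^bold>\<oplus> y) = h x \<^bold>\<oplus> h y"
proof (rule le_antisym)
  define z where "z = h (x \<^bold>\<oplus> y)"
  have z[simp]: "z \<in> carrier M" "z \<^bold>\<le> b" "z \<^bold>\<oplus> z = x \<^bold>\<oplus> y" by (auto simp: z_def)
  have hy: "h y \<^bold>\<le> z"
    unfolding z_def by (rule h_mono) auto
  define p where "p = z \<^bold>\<ominus> h y"
  have p[simp]: "p \<in> carrier M" "p \<^bold>\<le> b" and zp: "z = h y \<^bold>\<oplus> p"
    using le_trans[of p z b] by (auto simp: p_def plus_minus hy)
  have "x \<^bold>\<oplus> y = (h y \<^bold>\<oplus> p) \<^bold>\<oplus> (h y \<^bold>\<oplus> p)"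
    using z(3) zp by simp
  also have "\<dots> = (p \<^bold>\<oplus> p) \<^bold>\<oplus> (h y \<^bold>\<oplus> h y)"
    by (simp add: plus_ac del: h_double)
  finally have "x \<^bold>\<le> p \<^bold>\<oplus> p"
    using plus_le_cancel[OF top_idem assms(1-4) _ le, of "p \<^bold>\<oplus> p"] by simp
  then have "h x \<^bold>\<le> p" by (simp add: h_least)
  then show "h x \<^bold>\<oplus> h y \<^bold>\<le> h (x \<^bold>\<oplus> y)"
    using plus_mono[of "h x" p "h y"] zp z_def by (simp add: plus_comm[of p "h y"])
qed (auto simp: h_plus_le)

text \<open>In the intended product, with \<open>b = (v, u)\<close>, one has
  \<open>c = h b = (v, u/2)\<close> and \<open>t = (0, u/2)\<close>. Additivity applied to
  \<open>b = c \<oplus> t\<close> and \<open>c = t \<oplus> v\<close> gives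
  \<open>c = h t \<oplus> h t \<oplus> h v = t \<oplus> h v\<close>; comparison with
  \<open>c = t \<oplus> v\<close> yields \<open>h v = v\<close>.\<close>

lemma
  fixes t u v
  defines "t \<equiv> b \<^bold>\<ominus> h b"
  defines "u \<equiv> t \<^bold>\<oplus> t"
  defines "v \<equiv> b \<^bold>\<ominus> u"
  shows strict_part_idem: "u \<in> emv_idem M"
    and boolean_part: "\<lbrakk>x \<in> carrier M; x \<^bold>\<le> v\<rbrakk> \<Longrightarrow> x \<^bold>\<oplus> x = x"
proof -
  define c where "c = h b"
  have c[simp]: "c \<in> carrier M" "c \<^bold>\<le> b" by (auto simp: c_def)
  have t[simp]: "t \<in> carrier M" "t \<^bold>\<le> b" by (auto simp: t_def)
  have bt: "b \<^bold>\<ominus> t = c" by (simp add: t_def c_def minus_minus_idem top_idem)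
  have tc: "t \<^bold>\<le> c" by (simp add: t_def c_def minus_le_iff)
  have u[simp]: "u \<in> carrier M" "u \<^bold>\<le> b" by (auto simp: u_def)
  have v[simp]: "v \<in> carrier M" "v \<^bold>\<le> b" by (auto simp: v_def)
  have vc: "v = c \<^bold>\<ominus> t" by (simp add: v_def u_def minus_plus bt)
  then have tv: "t \<^bold>\<oplus> v = c" and vle: "v \<^bold>\<le> c" by (simp_all add: plus_minus tc)
  have hv: "h v = v"
  proof (rule le_antisym)
    have "b = c \<^bold>\<oplus> t"
      using plus_minus[of c b] by (simp add: t_def c_def)
    then have "c = h c \<^bold>\<oplus> h t"
      using h_plus[of c t] by (simp add: c_def bt)
    also have "h c = h t \<^bold>\<oplus> h v"
      unfolding tv[symmetric]
      using le_minus_swap[OF top_idem v t] by (intro h_plus) (auto simp: bt vle)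
    finally have "c = (h t \<^bold>\<oplus> h t) \<^bold>\<oplus> h v"
      by (simp add: plus_ac del: h_double)
    then have "v \<^bold>\<oplus> t = h v \<^bold>\<oplus> t"
      using tv by (simp add: plus_comm[of t])
    then show "v \<^bold>\<le> h v"
      using plus_le_cancel[OF top_idem v t, of "h v"] by (simp add: bt vle)
  qed (auto simp: h_le_self)
  then have "v \<^bold>\<oplus> v = v" using h_double[of v] by simp
  then have vI: "v \<in> emv_idem M" by (simp add: emv_idem_def)
  have "u = b \<^bold>\<ominus> v" by (simp add: v_def minus_minus_idem top_idem)
  then show "u \<in> emv_idem M" by (simp add: compl_idem vI top_idem)
  show "x \<^bold>\<oplus> x = x" if x[simp]: "x \<in> carrier M" "x \<^bold>\<le> v"
  proof -
    have xb[simp]: "x \<^bold>\<le> b" by (rule le_trans[of _ v]) auto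
    define w where "w = v \<^bold>\<ominus> x"
    have w[simp]: "w \<in> carrier M" "x \<^bold>\<oplus> w = v" "w \<^bold>\<le> v" by (auto simp: w_def plus_minus)
    have wb[simp]: "w \<^bold>\<le> b" by (rule le_trans[of _ v]) auto
    have "w \<^bold>\<le> b \<^bold>\<ominus> x" by (simp add: w_def minus_mono)
    then have xw: "x \<^bold>\<le> b \<^bold>\<ominus> w" by (rule le_minus_swap[OF top_idem w(1) wb x(1) xb])
    \<comment> \<open>Halving fixes \<open>v\<close> and can only shrink its summands
      \<open>x\<close> and \<open>w\<close>, so it must fix each of them.\<close>
    have "x \<^bold>\<oplus> w = h x \<^bold>\<oplus> h w"
      using h_plus[OF x(1) xb w(1) wb xw] hv by simp
    also have "\<dots> \<^bold>\<le> h x \<^bold>\<oplus> w"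
      by (intro plus_mono2) (auto simp: h_le_self)
    finally have "x \<^bold>\<le> h x"
      using plus_le_cancel[OF top_idem x(1) xb w(1) wb _ xw, of "h x"] by simp
    then have "h x = x" by (simp add: le_antisym h_le_self)
    then show ?thesis using h_double[of x] by simp
  qed
qed

end

section \<open>Midpoints in a strict algebra\<close>

locale strict_emv_halving = emv_halving +
  assumes strict: "b \<^bold>\<ominus> h b = h b"
begin

lemma h_le_center: "\<lbrakk>x \<in> carrier M; x \<^bold>\<le> b\<rbrakk> \<Longrightarrow> h x \<^bold>\<le> h b"
  by (simp add: h_mono)

text \<open>All halves lie below \<open>h b\<close>, which is its own complement. Sums of two halves
  therefore never overflow, and additivity and cancellation hold for them unconditionally.\<close>

lemma h_disjoint:
  assumes [simp]: "x \<in> carrier M" "x \<^bold>\<le> b" "y \<in> carrier M" "y \<^bold>\<le> b"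
  shows "h x \<^bold>\<le> b \<^bold>\<ominus> h y"
proof -
  have "h x \<^bold>\<le> b \<^bold>\<ominus> h b" by (simp add: strict h_le_center)
  also have "\<dots> \<^bold>\<le> b \<^bold>\<ominus> h y" by (intro minus_mono) (auto simp: h_le_center)
  finally show ?thesis by simp
qed

text \<open>Below the centre doubling does not overflow, so \<open>h\<close> inverts it there;
  \<open>[0, h b]\<close> is exactly the set of halves.\<close>

lemma h_plus_self:
  assumes [simp]: "w \<in> carrier M" "w \<^bold>\<le> h b"
  shows "h (w \<^bold>\<oplus> w) = w" and "w \<^bold>\<le> b"
proof -
  show wb: "w \<^bold>\<le> b" by (rule le_trans[of _ "h b"]) auto
  have "h b \<^bold>\<le> b \<^bold>\<ominus> w" using wb le_minus_swap[OF top_idem, of w "h b"] by (simp add: strict)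
  then have "w \<^bold>\<le> b \<^bold>\<ominus> w" using le_trans[of w "h b" "b \<^bold>\<ominus> w"] by simp
  then show "h (w \<^bold>\<oplus> w) = w" using wb by (simp add: h_plus)
qed

abbreviation "mid x y \<equiv> h x \<^bold>\<oplus> h y"

lemma midpoint_lattice_segment:
  "midpoint_lattice (emv_segment M b) (le (emv_order M)) (\<^bold>\<or>) (\<^bold>\<and>) mid (\<lambda>x. b \<^bold>\<ominus> x) \<^bold>\<zero> b"
proof (unfold_locales, unfold mem_segment, goal_cases)
  case (2 x y) then show ?case by (simp add: le_antisym)
next
  case (3 x y z) then show ?case by (blast intro: le_trans)
next
  case (8 x y) then show ?case using le_trans[of "x \<^bold>\<and> y" x b] by simp
next
  case (17 x y)
  then show ?case by (simp add: plus_comm)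
next
  case (19 x y z w)
  then show ?case
    by (simp add: h_plus h_disjoint plus_ac)
next
  case (20 x y z)
  then have [simp]: "x \<in> carrier M" "x \<^bold>\<le> b" "y \<in> carrier M" "y \<^bold>\<le> b" "z \<in> carrier M" "z \<^bold>\<le> b" by auto
  show ?case
  proof
    assume "mid x z \<^bold>\<le> mid y z"
    then have "h x \<^bold>\<le> h y"
      using plus_le_cancel[OF top_idem, of "h x" "h z" "h y"] by (simp add: h_disjoint)
    then show "x \<^bold>\<le> y" using plus_mono2[of "h x" "h y" "h x" "h y"] by simp
  qed (simp add: plus_mono h_mono)
next
  case (21 z p)
  then have [simp]: "z \<in> carrier M" "z \<^bold>\<le> b" "p \<in> carrier M" "p \<^bold>\<le> b" by auto
  \<comment> \<open>The part of \<open>z\<close> beyond \<open>h p\<close> is at most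
    \<open>h b\<close>, hence the half of its own double \<open>w \<oplus> w\<close>, which is the
    required witness.\<close>
  define w where "w = z \<^bold>\<ominus> h p"
  have "h p \<^bold>\<le> z" using 21(3) by simp
  then have z: "z = w \<^bold>\<oplus> h p" and w[simp]: "w \<in> carrier M"
    using plus_minus[of "h p" z] by (auto simp: w_def plus_comm[of "h p"])
  have wb[simp]: "w \<^bold>\<le> h b" using 21(4) by (simp add: w_def minus_le_iff plus_comm[of "h p"])
  show ?case
    by (rule bexI[of _ "w \<^bold>\<oplus> w"]) (auto simp: z h_plus_self mem_segment)
next
  case (23 x)
  then have "x \<^bold>\<le> b \<^bold>\<ominus> (b \<^bold>\<ominus> x)" by (simp add: minus_minus_idem top_idem)
  then show ?case using 23 h_plus[of x "b \<^bold>\<ominus> x"] by (simp add: plus_minus)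
qed (auto simp: join_least meet_greatest)

text \<open>This supplies the hypothesis \<open>mid_pl\<close> of \<open>iota_iso\<close>. An
  element \<open>z\<close> below both terms on the right is the half of \<open>z \<oplus> z\<close>,
  and \<open>z \<oplus> z \<le> x \<oplus> y\<close>.\<close>

lemma h_plus_meet:
  assumes [simp]: "x \<in> carrier M" "x \<^bold>\<le> b" "y \<in> carrier M" "y \<^bold>\<le> b"
  shows "h (x \<^bold>\<oplus> y) = (h x \<^bold>\<oplus> h y) \<^bold>\<and> h b"
proof (rule le_antisym)
  define z where "z = (h x \<^bold>\<oplus> h y) \<^bold>\<and> h b"
  have z[simp]: "z \<in> carrier M" "z \<^bold>\<le> h b" "z \<^bold>\<le> h x \<^bold>\<oplus> h y" by (auto simp: z_def)
  have "z \<^bold>\<oplus> z \<^bold>\<le> (h x \<^bold>\<oplus> h y) \<^bold>\<oplus> (h x \<^bold>\<oplus> h y)" by (rule plus_mono2) auto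
  also have "\<dots> = (h x \<^bold>\<oplus> h x) \<^bold>\<oplus> (h y \<^bold>\<oplus> h y)" by (simp add: plus_ac del: h_double)
  finally have "h (z \<^bold>\<oplus> z) \<^bold>\<le> h (x \<^bold>\<oplus> y)" by (intro h_mono) auto
  then show "(h x \<^bold>\<oplus> h y) \<^bold>\<and> h b \<^bold>\<le> h (x \<^bold>\<oplus> y)"
    by (simp add: h_plus_self flip: z_def)
qed (auto simp: meet_greatest h_plus_le h_le_center)

end

section \<open>Segments and isomorphic copies\<close>

text \<open>The carrier is an arbitrary set because the Boolean factor of a proper algebra has no
  top and is not a segment.\<close>

definition sub_emv :: "('a, 'm) emv_scheme \<Rightarrow> 'a set \<Rightarrow> 'a emv" where
  "sub_emv M A = \<lparr>carrier = A, emv_join = emv_join M, emv_meet = emv_meet M,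
     emv_plus = emv_plus M, emv_zero = emv_zero M\<rparr>"

lemma sub_emv_simps [simp]:
  "carrier (sub_emv M A) = A"
  "x \<^bold>\<or>\<^bsub>sub_emv M A\<^esub> y = x \<^bold>\<or>\<^bsub>M\<^esub> y"
  "x \<^bold>\<and>\<^bsub>sub_emv M A\<^esub> y = x \<^bold>\<and>\<^bsub>M\<^esub> y"
  "x \<^bold>\<oplus>\<^bsub>sub_emv M A\<^esub> y = x \<^bold>\<oplus>\<^bsub>M\<^esub> y"
  "emv_plus (sub_emv M A) = emv_plus M"
  "\<^bold>\<zero>\<^bsub>sub_emv M A\<^esub> = \<^bold>\<zero>\<^bsub>M\<^esub>"
  "x \<^bold>\<le>\<^bsub>sub_emv M A\<^esub> y \<longleftrightarrow> x \<^bold>\<le>\<^bsub>M\<^esub> y"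
  by (simp_all add: sub_emv_def emv_order_def)

lemma (in distrib_lattice_bot) distrib_lattice_bot_sub_emv:
  assumes "A \<subseteq> carrier M" "\<^bold>\<zero> \<in> A"
    and "\<And>x y. \<lbrakk>x \<in> A; y \<in> A\<rbrakk> \<Longrightarrow> x \<^bold>\<or> y \<in> A" "\<And>x y. \<lbrakk>x \<in> A; y \<in> A\<rbrakk> \<Longrightarrow> x \<^bold>\<and> y \<in> A"
  shows "distrib_lattice_bot (sub_emv M A)"
  using assms
  by unfold_locales (auto simp: subset_iff join_assoc meet_assoc join_meet_absorb
      meet_join_absorb meet_join_distrib intro: join_comm meet_comm)

section \<open>Segments below an idempotent\<close>

context emv_algebra
begin

context
  fixes a assumes a: "a \<in> emv_idem M"
begin

abbreviation "S \<equiv> sub_emv M (emv_segment M a)"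

lemma idem_sub_segment: "emv_idem S = {b \<in> emv_idem M. b \<^bold>\<le> a}"
  by (auto simp: emv_idem_def mem_segment)

lemma segment_sub_segment: "\<lbrakk>b \<in> carrier M; b \<^bold>\<le> a\<rbrakk> \<Longrightarrow> emv_segment S b = emv_segment M b"
  using idem_closed[OF a] le_trans[of _ b a]
  by (auto simp: at_least_at_most_def mem_segment) (auto simp: emv_order_def)

lemma is_lam_sub_segment:
  "\<lbrakk>b \<in> carrier M; b \<^bold>\<le> a\<rbrakk> \<Longrightarrow> emv_is_lam S b x l \<longleftrightarrow> emv_is_lam M b x l"
  unfolding emv_is_lam_def least_def
  using segment_sub_segment[of b] idem_closed[OF a] le_trans[of _ b a]
  by (auto simp: emv_order_def[of S] mem_segment) (auto simp: emv_order_def[of M])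

lemma lam_sub_segment: "\<lbrakk>b \<in> carrier M; b \<^bold>\<le> a\<rbrakk> \<Longrightarrow> emv_lam S b x = emv_lam M b x"
  by (simp add: emv_lam_def is_lam_sub_segment)

lemma emv_algebra_sub_segment: "emv_algebra S"
proof -
  note [simp] = idem_closed[OF a]
  interpret S: distrib_lattice_bot S
  proof (rule distrib_lattice_bot_sub_emv)
    fix x y assume "x \<in> emv_segment M a" "y \<in> emv_segment M a"
    then show "x \<^bold>\<or> y \<in> emv_segment M a" "x \<^bold>\<and> y \<in> emv_segment M a"
      using le_trans[of "x \<^bold>\<and> y" x a] by (auto simp: mem_segment intro: join_least)
  qed (auto simp: mem_segment)
  show ?thesis
  proof (intro emv_algebra.intro emv_algebra_axioms.intro S.distrib_lattice_bot_axioms)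
    show "comm_monoid \<lparr>carrier = carrier S, mult = emv_plus S, one = \<^bold>\<zero>\<^bsub>S\<^esub>\<rparr>"
      using segment_mv[OF a] by (simp add: mv_algebra_def)
    show "\<exists>l. emv_is_lam S b x l" if "b \<in> emv_idem S" "x \<in> emv_segment S b" for b x
    proof -
      have b: "b \<in> emv_idem M" "b \<^bold>\<le> a" using that(1) by (simp_all add: idem_sub_segment)
      then have "x \<in> emv_segment M b" using that(2) segment_sub_segment idem_closed by blast
      then show ?thesis using lam_exists[of b x] b by (simp add: is_lam_sub_segment idem_closed)
    qed
    show "mv_algebra (emv_segment S b) (emv_plus S) (emv_lam S b) \<^bold>\<zero>\<^bsub>S\<^esub> b" if "b \<in> emv_idem S" for b
    proof -
      have "emv_lam S b = emv_lam M b"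
        using that by (auto simp: idem_sub_segment lam_sub_segment idem_closed fun_eq_iff)
      moreover have "emv_segment S b = emv_segment M b" "b \<in> emv_idem M"
        using that idem_closed by (simp_all only: idem_sub_segment mem_Collect_eq segment_sub_segment)
      ultimately show ?thesis
        using segment_mv[of b] by (simp only: sub_emv_simps)
    qed
    show "\<exists>b\<in>emv_idem S. x \<^bold>\<le>\<^bsub>S\<^esub> b" if "x \<in> carrier S" for x
      using that a by (auto simp: idem_sub_segment mem_segment)
  qed (auto simp: plus_mono mem_segment)
qed

text \<open>The \<open>SOME\<close> inside \<open>emv_odot\<close> may select different idempotents
  in the two algebras; both products are evaluated at \<open>a\<close> instead.\<close>

lemma odot_sub_segment:
  assumes "x \<in> emv_segment M a" "y \<in> emv_segment M a"
  shows "emv_odot S x y = emv_odot M x y"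
proof -
  interpret S: emv_algebra S by (rule emv_algebra_sub_segment)
  have "a \<in> emv_idem S" by (simp add: idem_sub_segment a idem_closed)
  then show ?thesis
    using S.odot_eq_lam[of a x y] odot_eq_lam[of a x y] assms a
    by (simp add: mem_segment lam_sub_segment idem_closed)
qed

end

end

section \<open>Transport along an isomorphism\<close>

locale emv_isomorphism = emv_algebra M for M :: "('a, 'm) emv_scheme" (structure) +
  fixes N :: "('b, 'n) emv_scheme" and f :: "'a \<Rightarrow> 'b"
  assumes iso: "f \<in> emv_iso M N"
begin

lemma f_closed [simp]: "x \<in> carrier M \<Longrightarrow> f x \<in> carrier N"
  and f_eq_iff [simp]: "\<lbrakk>x \<in> carrier M; y \<in> carrier M\<rbrakk> \<Longrightarrow> f x = f y \<longleftrightarrow> x = y"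
  and f_join: "\<lbrakk>x \<in> carrier M; y \<in> carrier M\<rbrakk> \<Longrightarrow> f x \<^bold>\<or>\<^bsub>N\<^esub> f y = f (x \<^bold>\<or> y)"
  and f_meet: "\<lbrakk>x \<in> carrier M; y \<in> carrier M\<rbrakk> \<Longrightarrow> f x \<^bold>\<and>\<^bsub>N\<^esub> f y = f (x \<^bold>\<and> y)"
  and f_plus: "\<lbrakk>x \<in> carrier M; y \<in> carrier M\<rbrakk> \<Longrightarrow> f x \<^bold>\<oplus>\<^bsub>N\<^esub> f y = f (x \<^bold>\<oplus> y)"
  and f_zero: "\<^bold>\<zero>\<^bsub>N\<^esub> = f \<^bold>\<zero>"
  and f_image: "carrier N = f ` carrier M"
  using iso by (auto simp: emv_iso_def bij_betw_def inj_on_eq_iff)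

lemmas f_ops [simp] = f_join f_meet f_plus

lemma f_le [simp]: "\<lbrakk>x \<in> carrier M; y \<in> carrier M\<rbrakk> \<Longrightarrow> f x \<^bold>\<le>\<^bsub>N\<^esub> f y \<longleftrightarrow> x \<^bold>\<le> y"
  by (simp add: emv_order_def)

lemma f_idem [simp]: "x \<in> carrier M \<Longrightarrow> f x \<in> emv_idem N \<longleftrightarrow> x \<in> emv_idem M"
  by (simp add: emv_idem_def)

lemma idem_image: "emv_idem N = f ` emv_idem M"
  by (auto simp: emv_idem_def f_image)

lemma segment_image: "a \<in> carrier M \<Longrightarrow> emv_segment N (f a) = f ` emv_segment M a"
  by (auto simp: mem_segment) (auto simp: at_least_at_most_def emv_order_def[of N] f_image f_zero le_iff_join)

lemma f_is_lam:
  assumes [simp]: "a \<in> carrier M" "x \<in> carrier M" "l \<in> carrier M"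
  shows "emv_is_lam N (f a) (f x) (f l) \<longleftrightarrow> emv_is_lam M a x l"
proof -
  have 1: "{z \<in> emv_segment N (f a). f x \<^bold>\<oplus>\<^bsub>N\<^esub> z = f a} = f ` {z \<in> emv_segment M a. x \<^bold>\<oplus> z = a}" (is "_ = f ` ?Z")
    by (auto simp: segment_image mem_segment)
  have Z: "?Z \<subseteq> carrier M" by (auto simp: mem_segment)
  then have 2: "f ` ?Z \<subseteq> carrier (emv_order N)" and "f l \<in> f ` ?Z \<longleftrightarrow> l \<in> ?Z"
    by (auto simp: emv_order_def f_image mem_segment)
  then show ?thesis
    unfolding emv_is_lam_def least_def 1 using Z by (auto simp: subset_iff)
qed

lemma distrib_lattice_bot_image: "distrib_lattice_bot N"
  by unfold_locales
    (auto simp: f_image f_zero join_assoc meet_assoc join_meet_absorb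
      meet_join_absorb meet_join_distrib intro: join_comm meet_comm)

text \<open>\<open>N\<close> is not yet known to be an EMV-algebra, so uniqueness of the minimum is
  pulled back to \<open>M\<close>.\<close>

lemma f_lam:
  assumes a: "a \<in> emv_idem M" and x: "x \<in> carrier M" "x \<^bold>\<le> a"
  shows "emv_lam N (f a) (f x) = f (emv_lam M a x)"
proof -
  note [simp] = idem_closed[OF a] x lam_closed(1)[OF a x]
  have "emv_is_lam N (f a) (f x) (f (emv_lam M a x))"
    by (simp add: f_is_lam is_lam_lam[OF a x])
  moreover have "l = f (emv_lam M a x)" if l: "emv_is_lam N (f a) (f x) l" for l
  proof -
    have "l \<in> carrier N" using l by (auto simp: emv_is_lam_def least_def emv_order_def)
    then obtain l' where "l' \<in> carrier M" "l = f l'" by (auto simp: f_image)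
    moreover from this l have "emv_is_lam M a x l'" by (simp add: f_is_lam)
    ultimately show ?thesis using is_lam_unique is_lam_lam[OF a x] by blast
  qed
  ultimately show ?thesis
    unfolding emv_lam_def[of N] by (rule the_equality)
qed

text \<open>Only \<open>M\<close> is assumed to be an EMV-algebra. Applied to \<open>iota\<close>,
  this gives the EMV axioms for \<open>mv_Gamma\<close> without any computation in the
  group.\<close>

lemma emv_algebra_image: "emv_algebra N"
proof -
  interpret N: distrib_lattice_bot N by (rule distrib_lattice_bot_image)
  show ?thesis
  proof (intro emv_algebra.intro emv_algebra_axioms.intro N.distrib_lattice_bot_axioms)
    show "comm_monoid \<lparr>carrier = carrier N, mult = emv_plus N, one = \<^bold>\<zero>\<^bsub>N\<^esub>\<rparr>"
      by (intro comm_monoidI) (auto simp: f_image f_zero plus_assoc intro: plus_comm)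
  next
    fix b y assume "b \<in> emv_idem N" "y \<in> emv_segment N b"
    then obtain a x where "a \<in> emv_idem M" "b = f a" "x \<in> emv_segment M a" "y = f x"
      by (auto simp: idem_image segment_image idem_closed)
    then show "\<exists>l. emv_is_lam N b y l"
      using is_lam_lam[of a x] f_is_lam[of a x "emv_lam M a x"]
      by (auto simp: mem_segment idem_closed lam_closed)
  next
    fix b assume "b \<in> emv_idem N"
    then obtain a where a: "a \<in> emv_idem M" and b: "b = f a" by (auto simp: idem_image)
    interpret mv: mv_algebra "emv_segment M a" "(\<^bold>\<oplus>)" "emv_lam M a" "\<^bold>\<zero>" a by (rule segment_mv[OF a])
    note [simp] = idem_closed[OF a]
    have seg: "emv_segment N b = f ` emv_segment M a" by (simp add: b segment_image)
    have "mv_algebra (f ` emv_segment M a) (emv_plus N) (emv_lam N (f a)) \<^bold>\<zero>\<^bsub>N\<^esub> (f a)"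
    proof (intro mv_algebra.intro)
      show "comm_monoid \<lparr>carrier = f ` emv_segment M a, mult = emv_plus N, one = \<^bold>\<zero>\<^bsub>N\<^esub>\<rparr>"
        by (intro comm_monoidI) (auto simp: mem_segment f_zero plus_assoc plus_le_idem[OF a] intro: plus_comm)
    qed (use mv.neg_closed mv.neg_neg mv.neg_zero mv.pl_top mv.lukasiewicz
          in \<open>auto simp: mem_segment f_zero f_lam a lam_closed plus_le_idem\<close>)
    then show "mv_algebra (emv_segment N b) (emv_plus N) (emv_lam N b) \<^bold>\<zero>\<^bsub>N\<^esub> b"
      using seg b by simp
  next
    fix y assume "y \<in> carrier N"
    then obtain x where x: "x \<in> carrier M" "y = f x" by (auto simp: f_image)
    then obtain a where "a \<in> emv_idem M" "x \<^bold>\<le> a" using idem_cofinal by blast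
    then show "\<exists>a\<in>emv_idem N. y \<^bold>\<le>\<^bsub>N\<^esub> a"
      using x by (auto simp: idem_image idem_closed)
  qed (auto simp: f_image plus_mono)
qed

lemma f_odot:
  assumes x: "x \<in> carrier M" and y: "y \<in> carrier M"
  shows "emv_odot N (f x) (f y) = f (emv_odot M x y)"
proof -
  interpret N: emv_algebra N by (rule emv_algebra_image)
  obtain a where a: "a \<in> emv_idem M" "x \<^bold>\<le> a" "y \<^bold>\<le> a" using idem_above2 assms .
  then show ?thesis
    using N.odot_eq_lam[of "f a" "f x" "f y"] odot_eq_lam[of a x y] x y
    by (simp add: f_lam idem_closed lam_closed plus_le_idem)
qed

lemma square_root_image:
  assumes s: "emv_square_root M s"
  shows "emv_square_root N (\<lambda>y. f (s (inv_into (carrier M) f y)))"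
proof -
  have inj: "inj_on f (carrier M)" by (simp add: inj_on_def)
  have [simp]: "s x \<in> carrier M" if "x \<in> carrier M" for x
    using s that by (auto simp: emv_square_root_def)
  have "emv_odot M y y \<in> carrier M" if y: "y \<in> carrier M" for y
  proof -
    obtain a where "a \<in> emv_idem M" "y \<^bold>\<le> a" using idem_cofinal y by blast
    then show ?thesis using odot_eq[of a y y] y by (simp add: idem_closed)
  qed
  then show ?thesis
    using s by (auto simp: emv_square_root_def f_image f_odot inv_into_f_f[OF inj])
qed

end

section \<open>Decomposition along a square root\<close>

locale emv_root = emv_algebra M for M (structure) +
  fixes r
  assumes root: "emv_square_root M r"
begin

section \<open>Order properties of the root\<close>

lemma r_closed [simp]: "x \<in> carrier M \<Longrightarrow> r x \<in> carrier M"
  using root by (auto simp: emv_square_root_def)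

lemma r_square: "\<lbrakk>a \<in> emv_idem M; x \<in> carrier M; r x \<^bold>\<le> a\<rbrakk> \<Longrightarrow> r x \<^bold>\<ominus> (a \<^bold>\<ominus> r x) = x"
  using root odot_eq[of a "r x" "r x"] by (simp add: emv_square_root_def)

lemma r_greatest:
  "\<lbrakk>a \<in> emv_idem M; x \<in> carrier M; y \<in> carrier M; y \<^bold>\<le> a; y \<^bold>\<ominus> (a \<^bold>\<ominus> y) \<^bold>\<le> x\<rbrakk> \<Longrightarrow> y \<^bold>\<le> r x"
  using root odot_eq[of a y y] by (simp add: emv_square_root_def)

lemma square_mono:
  assumes a: "a \<in> emv_idem M" and [simp]: "x \<in> carrier M" "y \<in> carrier M" and le: "x \<^bold>\<le> y"
  shows "x \<^bold>\<ominus> (a \<^bold>\<ominus> x) \<^bold>\<le> y \<^bold>\<ominus> (a \<^bold>\<ominus> y)"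
proof -
  note [simp] = idem_closed[OF a]
  have "a \<^bold>\<ominus> y \<^bold>\<le> a \<^bold>\<ominus> x" by (rule minus_mono) (auto simp: le)
  then show ?thesis by (intro minus_mono) (auto simp: le)
qed

lemma r_mono:
  assumes [simp]: "x \<in> carrier M" "y \<in> carrier M" and "x \<^bold>\<le> y"
  shows "r x \<^bold>\<le> r y"
proof -
  obtain a where "a \<in> emv_idem M" "r x \<^bold>\<le> a" using idem_cofinal r_closed assms(1) by blast
  then show ?thesis
    using r_greatest[of a y "r x"] r_square[of a x] assms by simp
qed

lemma le_r:
  assumes [simp]: "x \<in> carrier M"
  shows "x \<^bold>\<le> r x"
proof -
  obtain a where "a \<in> emv_idem M" "x \<^bold>\<le> a" using idem_cofinal assms by blast
  then show ?thesis using r_greatest[of a x x] by (simp add: idem_closed)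
qed

text \<open>The part \<open>y\<close> of \<open>r x\<close> outside \<open>b\<close> has a square
  below \<open>x \<le> b\<close> and also below \<open>y\<close>, so the square is \<open>0\<close>.
  Hence \<open>y \<le> r 0 \<le> b\<close>, which forces \<open>y = 0\<close>.\<close>

lemma r_le_idem:
  assumes b: "b \<in> emv_idem M" and t: "r \<^bold>\<zero> \<^bold>\<le> b" and x[simp]: "x \<in> carrier M" and xb: "x \<^bold>\<le> b"
  shows "r x \<^bold>\<le> b"
proof -
  note [simp] = idem_closed[OF b]
  obtain d where d: "d \<in> emv_idem M" "r x \<^bold>\<le> d" "b \<^bold>\<le> d" using idem_above2[of "r x" b] by auto
  note [simp] = idem_closed[OF d(1)]
  define y where "y = r x \<^bold>\<ominus> b"
  have y[simp]: "y \<in> carrier M" and yr: "y \<^bold>\<le> r x" by (auto simp: y_def)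
  have yd: "y \<^bold>\<le> d" by (rule le_trans[OF yr d(2)]) auto
  have "y = r x \<^bold>\<and> (d \<^bold>\<ominus> b)"
    unfolding y_def by (rule minus_idem_eq_meet[OF b d(1,3) _ d(2)]) auto
  then have "y \<^bold>\<and> b = r x \<^bold>\<and> (b \<^bold>\<and> (d \<^bold>\<ominus> b))"
    by (simp add: meet_assoc meet_comm[of b])
  also have "\<dots> = r x \<^bold>\<and> \<^bold>\<zero>" by (simp add: idem_meet_compl[OF b d(1,3)])
  also have "\<dots> = \<^bold>\<zero>" by (simp add: le_zero)
  finally have disj: "y \<^bold>\<and> b = \<^bold>\<zero>" .
  define q where "q = y \<^bold>\<ominus> (d \<^bold>\<ominus> y)"
  have [simp]: "q \<in> carrier M" "q \<^bold>\<le> y" by (auto simp: q_def)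
  have "q \<^bold>\<le> x"
    using square_mono[OF d(1) _ _ yr] r_square[OF d(1) x d(2)] by (simp add: q_def)
  then have "q \<^bold>\<le> y \<^bold>\<and> b"
    using le_trans[OF _ xb, of q] by (intro meet_greatest) auto
  then have "q \<^bold>\<le> \<^bold>\<zero>" by (simp add: disj)
  then have "y \<^bold>\<le> r \<^bold>\<zero>"
    using r_greatest[OF d(1), of "\<^bold>\<zero>" y] yd by (simp add: q_def)
  then have "y \<^bold>\<le> b" using t le_trans[of y "r \<^bold>\<zero>" b] by simp
  then have "y = \<^bold>\<zero>" using disj le_iff_meet[of y b] by simp
  then show ?thesis by (simp add: y_def minus_eq_zero_iff)
qed

lemma r_zero_disjoint:
  assumes b: "b \<in> emv_idem M" and t: "r \<^bold>\<zero> \<^bold>\<le> b"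
  shows "r \<^bold>\<zero> \<^bold>\<le> b \<^bold>\<ominus> r \<^bold>\<zero>"
  using r_square[OF b zero_closed t] idem_closed[OF b] by (simp add: minus_eq_zero_iff)

text \<open>The halving \<open>x \<mapsto> x/2\<close> is conjugate to the square root \<open>x \<mapsto> (x + b)/2\<close> under \<open>x \<mapsto> b - x\<close>.\<close>

lemma emv_halving_r:
  assumes b: "b \<in> emv_idem M" and t: "r \<^bold>\<zero> \<^bold>\<le> b"
  shows "emv_halving M b (\<lambda>x. b \<^bold>\<ominus> r (b \<^bold>\<ominus> x))"
proof
  note [simp] = idem_closed[OF b]
  show "b \<in> emv_idem M" by (rule b)
  fix x assume x[simp]: "x \<in> carrier M" "x \<^bold>\<le> b"
  define q where "q = r (b \<^bold>\<ominus> x)"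
  have q[simp]: "q \<in> carrier M" "q \<^bold>\<le> b" by (auto simp: q_def r_le_idem b t)
  show "b \<^bold>\<ominus> r (b \<^bold>\<ominus> x) \<in> carrier M" by simp
  have qq: "q \<^bold>\<ominus> (b \<^bold>\<ominus> q) = b \<^bold>\<ominus> x"
    using r_square[OF b, of "b \<^bold>\<ominus> x"] q(2) by (simp add: q_def)
  have "(b \<^bold>\<ominus> q) \<^bold>\<oplus> (b \<^bold>\<ominus> q) = b \<^bold>\<ominus> (b \<^bold>\<ominus> ((b \<^bold>\<ominus> q) \<^bold>\<oplus> (b \<^bold>\<ominus> q)))"
    by (rule minus_minus_idem[OF b, symmetric]) (simp_all add: plus_le_idem b)
  also have "b \<^bold>\<ominus> ((b \<^bold>\<ominus> q) \<^bold>\<oplus> (b \<^bold>\<ominus> q)) = b \<^bold>\<ominus> x"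
    by (simp add: minus_plus minus_minus_idem b qq)
  also have "b \<^bold>\<ominus> (b \<^bold>\<ominus> x) = x" by (rule minus_minus_idem[OF b x])
  finally have "(b \<^bold>\<ominus> q) \<^bold>\<oplus> (b \<^bold>\<ominus> q) = x" .
  then show "(b \<^bold>\<ominus> r (b \<^bold>\<ominus> x)) \<^bold>\<oplus> (b \<^bold>\<ominus> r (b \<^bold>\<ominus> x)) = x" by (simp add: q_def)
  fix y assume y[simp]: "y \<in> carrier M" "y \<^bold>\<le> b" and le: "x \<^bold>\<le> y \<^bold>\<oplus> y"
  have "(b \<^bold>\<ominus> y) \<^bold>\<ominus> (b \<^bold>\<ominus> (b \<^bold>\<ominus> y)) = b \<^bold>\<ominus> (y \<^bold>\<oplus> y)"
    by (simp add: minus_plus minus_minus_idem b)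
  also have "\<dots> \<^bold>\<le> b \<^bold>\<ominus> x" by (rule minus_mono) (auto simp: le)
  finally have "b \<^bold>\<ominus> y \<^bold>\<le> q"
    unfolding q_def by (intro r_greatest[OF b]) auto
  then show "b \<^bold>\<ominus> r (b \<^bold>\<ominus> x) \<^bold>\<le> y"
    using minus_swap_le[OF b q y] by (simp add: q_def)
qed

section \<open>The strict part below \<open>u\<close>\<close>

definition "u = r \<^bold>\<zero> \<^bold>\<oplus> r \<^bold>\<zero>"

lemma u_closed [simp]: "u \<in> carrier M"
  by (simp add: u_def)

lemma r_zero_le_u [simp]: "r \<^bold>\<zero> \<^bold>\<le> u"
  by (simp add: u_def)

text \<open>For the halving conjugate to \<open>r\<close>, the element
  \<open>b \<ominus> h b\<close> is \<open>r 0\<close> whatever \<open>b\<close> is. Thus all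
  segments produce the same \<open>u\<close>.\<close>

lemma
  assumes b: "b \<in> emv_idem M" and t: "r \<^bold>\<zero> \<^bold>\<le> b"
  shows u_idem_if: "u \<in> emv_idem M"
    and boolean_compl: "\<lbrakk>x \<in> carrier M; x \<^bold>\<le> b \<^bold>\<ominus> u\<rbrakk> \<Longrightarrow> x \<^bold>\<oplus> x = x"
proof -
  interpret emv_halving M b "\<lambda>x. b \<^bold>\<ominus> r (b \<^bold>\<ominus> x)" by (rule emv_halving_r[OF b t])
  have "b \<^bold>\<ominus> (b \<^bold>\<ominus> r (b \<^bold>\<ominus> b)) = r \<^bold>\<zero>"
    using minus_eq_zero_iff[of b b] by (simp add: minus_minus_idem b t)
  then show "u \<in> emv_idem M" "\<lbrakk>x \<in> carrier M; x \<^bold>\<le> b \<^bold>\<ominus> u\<rbrakk> \<Longrightarrow> x \<^bold>\<oplus> x = x"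
    using strict_part_idem boolean_part[of x] by (simp_all add: u_def)
qed

lemma u_idem: "u \<in> emv_idem M"
proof -
  obtain b where "b \<in> emv_idem M" "r \<^bold>\<zero> \<^bold>\<le> b" using idem_cofinal r_closed zero_closed by blast
  then show ?thesis by (rule u_idem_if)
qed

text \<open>\<open>r 0\<close> is half of \<open>u\<close>: one inequality says that its double
  reaches \<open>u\<close>, the other that its square vanishes.\<close>

lemma strict_r_zero: "u \<^bold>\<ominus> r \<^bold>\<zero> = r \<^bold>\<zero>"
  by (rule le_antisym) (simp_all add: r_zero_disjoint u_idem minus_le_iff u_def[symmetric])

lemma u_le_iff: "b \<in> emv_idem M \<Longrightarrow> u \<^bold>\<le> b \<longleftrightarrow> r \<^bold>\<zero> \<^bold>\<le> b"
  using plus_le_idem[of b "r \<^bold>\<zero>" "r \<^bold>\<zero>"] le_trans[of "r \<^bold>\<zero>" u b] idem_closed[of b]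
  by (auto simp: u_def)

lemma r_segment: "\<lbrakk>x \<in> carrier M; x \<^bold>\<le> u\<rbrakk> \<Longrightarrow> r x \<^bold>\<le> u"
  by (simp add: r_le_idem u_idem)

lemma strict_halving: "strict_emv_halving M u (\<lambda>x. u \<^bold>\<ominus> r (u \<^bold>\<ominus> x))"
proof -
  interpret emv_halving M u "\<lambda>x. u \<^bold>\<ominus> r (u \<^bold>\<ominus> x)" by (rule emv_halving_r) (simp_all add: u_idem)
  show ?thesis
    by unfold_locales (use minus_eq_zero_iff[of u u] strict_r_zero in simp)
qed

text \<open>Identifies the root on \<open>[0,u]\<close> with \<open>y \<mapsto> (y + u)/2\<close>.
  The halves \<open>p\<close> of \<open>y\<close> and \<open>q\<close> of \<open>u - y\<close> add
  up to \<open>u/2 = r 0\<close>, so \<open>p + u/2 = u - q\<close>, and \<open>u - q\<close> is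
  \<open>r y\<close> by the definition of the halving.\<close>

lemma mid_top_eq_r:
  assumes y[simp]: "y \<in> carrier M" "y \<^bold>\<le> u"
  shows "(u \<^bold>\<ominus> r (u \<^bold>\<ominus> y)) \<^bold>\<oplus> (u \<^bold>\<ominus> r (u \<^bold>\<ominus> u)) = r y"
proof -
  interpret strict_emv_halving M u "\<lambda>x. u \<^bold>\<ominus> r (u \<^bold>\<ominus> x)" by (rule strict_halving)
  interpret ml: midpoint_lattice "emv_segment M u" "le (emv_order M)" "(\<^bold>\<or>)" "(\<^bold>\<and>)" mid
    "\<lambda>x. u \<^bold>\<ominus> x" "\<^bold>\<zero>" u by (rule midpoint_lattice_segment)
  define p q where "p = u \<^bold>\<ominus> r (u \<^bold>\<ominus> y)" and "q = u \<^bold>\<ominus> r y"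
  have p[simp]: "p \<in> carrier M" "p \<^bold>\<le> u" and q[simp]: "q \<in> carrier M" "q \<^bold>\<le> u"
    by (simp_all add: p_def q_def)
  have uu: "u \<^bold>\<ominus> u = \<^bold>\<zero>" by (simp add: minus_eq_zero_iff)
  have yy: "u \<^bold>\<ominus> (u \<^bold>\<ominus> y) = y" by (simp add: minus_minus_idem u_idem)
  have pq: "q \<^bold>\<oplus> p = r \<^bold>\<zero>"
    using ml.mid_ng[of y] h_zero
    by (simp add: mem_segment yy uu strict_r_zero p_def q_def plus_comm[of "u \<^bold>\<ominus> r y"])
  have "q \<^bold>\<le> u \<^bold>\<ominus> p"
    using h_disjoint[of "u \<^bold>\<ominus> y" y] by (simp add: yy p_def q_def)
  then have "r \<^bold>\<zero> \<^bold>\<ominus> p = q"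
    using plus_minus_cancel[OF u_idem q p] by (simp add: pq)
  then have "u \<^bold>\<ominus> (p \<^bold>\<oplus> r \<^bold>\<zero>) = q"
    by (simp add: plus_comm[of p] minus_plus strict_r_zero)
  then have "p \<^bold>\<oplus> r \<^bold>\<zero> = u \<^bold>\<ominus> q"
    using minus_minus_idem[OF u_idem, of "p \<^bold>\<oplus> r \<^bold>\<zero>"] by simp
  also have "\<dots> = r y" by (simp add: q_def minus_minus_idem u_idem r_segment)
  finally show ?thesis by (simp add: p_def uu strict_r_zero)
qed

section \<open>Splitting elements along \<open>u\<close>\<close>

lemma minus_u_eq_meet:
  "\<lbrakk>b \<in> emv_idem M; u \<^bold>\<le> b; x \<in> carrier M; x \<^bold>\<le> b\<rbrakk> \<Longrightarrow> x \<^bold>\<ominus> u = (b \<^bold>\<ominus> u) \<^bold>\<and> x"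
  using minus_idem_eq_meet[OF u_idem, of b x] idem_closed[of b] by (simp add: meet_comm[of x])

lemma minus_u_meet: "x \<in> carrier M \<Longrightarrow> (x \<^bold>\<ominus> u) \<^bold>\<and> u = \<^bold>\<zero>"
proof -
  assume x[simp]: "x \<in> carrier M"
  obtain b where b: "b \<in> emv_idem M" "x \<^bold>\<le> b" "u \<^bold>\<le> b" using idem_above2[of x u] by auto
  note [simp] = idem_closed[OF b(1)]
  have "u \<^bold>\<and> (x \<^bold>\<ominus> u) = (u \<^bold>\<and> (b \<^bold>\<ominus> u)) \<^bold>\<and> x"
    by (simp add: minus_u_eq_meet[OF b(1,3) x b(2)] meet_assoc)
  then show ?thesis
    using idem_meet_compl[OF u_idem b(1,3)] le_zero[of "\<^bold>\<zero> \<^bold>\<and> x"] by (simp add: meet_comm[of u])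
qed

lemma minus_u_join_meet: "x \<in> carrier M \<Longrightarrow> (x \<^bold>\<ominus> u) \<^bold>\<or> (x \<^bold>\<and> u) = x"
proof -
  assume x[simp]: "x \<in> carrier M"
  obtain b where b: "b \<in> emv_idem M" "x \<^bold>\<le> b" "u \<^bold>\<le> b" using idem_above2[of x u] by auto
  note [simp] = idem_closed[OF b(1)]
  have "(x \<^bold>\<ominus> u) \<^bold>\<or> (x \<^bold>\<and> u) = (x \<^bold>\<and> u) \<^bold>\<or> (x \<^bold>\<and> (b \<^bold>\<ominus> u))"
    by (simp add: minus_u_eq_meet[OF b(1,3) x b(2)] join_comm[of "x \<^bold>\<and> u"] meet_comm[of x "b \<^bold>\<ominus> u"])
  also have "\<dots> = x \<^bold>\<and> b"
    by (simp add: meet_join_distrib[symmetric] idem_join_compl[OF u_idem b(1,3)])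
  finally show ?thesis using le_iff_meet[of x b] b(2) by simp
qed

lemma minus_u_disjoint: "\<lbrakk>x \<in> carrier M; x \<^bold>\<and> u = \<^bold>\<zero>\<rbrakk> \<Longrightarrow> x \<^bold>\<ominus> u = x"
  using minus_u_join_meet[of x] join_comm[of "x \<^bold>\<ominus> u" "\<^bold>\<zero>"] by simp

lemma disjoint_idem:
  assumes x[simp]: "x \<in> carrier M" and "x \<^bold>\<and> u = \<^bold>\<zero>"
  shows "x \<^bold>\<oplus> x = x"
proof -
  obtain b where b: "b \<in> emv_idem M" "x \<^bold>\<le> b" "u \<^bold>\<le> b" using idem_above2[of x u] by auto
  note [simp] = idem_closed[OF b(1)]
  have "x \<^bold>\<ominus> u \<^bold>\<le> b \<^bold>\<ominus> u" using b by (intro minus_mono) auto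
  then have "x \<^bold>\<le> b \<^bold>\<ominus> u" using assms minus_u_disjoint by simp
  then show ?thesis
    using boolean_compl[OF b(1), of x] b(3) by (simp add: u_le_iff b(1))
qed

text \<open>Below any idempotent \<open>b\<close> that bounds the arguments and \<open>u\<close>,
  subtracting \<open>u\<close> is the meet with the idempotent \<open>b \<ominus> u\<close>, which
  respects all three operations.\<close>

lemma minus_u_ops:
  assumes [simp]: "x \<in> carrier M" "y \<in> carrier M"
  shows "(x \<^bold>\<or> y) \<^bold>\<ominus> u = (x \<^bold>\<ominus> u) \<^bold>\<or> (y \<^bold>\<ominus> u)"
    and "(x \<^bold>\<and> y) \<^bold>\<ominus> u = (x \<^bold>\<ominus> u) \<^bold>\<and> (y \<^bold>\<ominus> u)"
    and "(x \<^bold>\<oplus> y) \<^bold>\<ominus> u = (x \<^bold>\<ominus> u) \<^bold>\<oplus> (y \<^bold>\<ominus> u)"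
proof -
  obtain b where b: "b \<in> emv_idem M" "x \<^bold>\<le> b" "y \<^bold>\<le> b" "u \<^bold>\<le> b" using idem_above3[of x y u] by auto
  note [simp] = idem_closed[OF b(1)]
  let ?v = "b \<^bold>\<ominus> u"
  have v: "?v \<in> emv_idem M" by (rule compl_idem[OF u_idem b(1,4)])
  have e: "z \<^bold>\<ominus> u = ?v \<^bold>\<and> z" if "z \<in> carrier M" "z \<^bold>\<le> b" for z
    using minus_u_eq_meet[OF b(1,4) that] .
  have [simp]: "x \<^bold>\<or> y \<^bold>\<le> b" "x \<^bold>\<oplus> y \<^bold>\<le> b" "x \<^bold>\<and> y \<^bold>\<le> b"
    using b le_trans[of "x \<^bold>\<and> y" x b] by (auto intro: join_least plus_le_idem)
  show "(x \<^bold>\<or> y) \<^bold>\<ominus> u = (x \<^bold>\<ominus> u) \<^bold>\<or> (y \<^bold>\<ominus> u)"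
    by (simp add: e[of "x \<^bold>\<or> y"] e[of x] e[of y] b meet_join_distrib)
  show "(x \<^bold>\<oplus> y) \<^bold>\<ominus> u = (x \<^bold>\<ominus> u) \<^bold>\<oplus> (y \<^bold>\<ominus> u)"
    by (simp add: e[of "x \<^bold>\<oplus> y"] e[of x] e[of y] b idem_meet_plus v)
  have "(?v \<^bold>\<and> x) \<^bold>\<and> (?v \<^bold>\<and> y) = ?v \<^bold>\<and> (x \<^bold>\<and> y)"
    by (rule meet_meet_distrib) simp_all
  then show "(x \<^bold>\<and> y) \<^bold>\<ominus> u = (x \<^bold>\<ominus> u) \<^bold>\<and> (y \<^bold>\<ominus> u)"
    by (simp add: e[of "x \<^bold>\<and> y"] e[of x] e[of y] b)
qed

lemma meet_u_ops:
  assumes [simp]: "x \<in> carrier M" "y \<in> carrier M"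
  shows "(x \<^bold>\<or> y) \<^bold>\<and> u = (x \<^bold>\<and> u) \<^bold>\<or> (y \<^bold>\<and> u)"
    and "(x \<^bold>\<and> y) \<^bold>\<and> u = (x \<^bold>\<and> u) \<^bold>\<and> (y \<^bold>\<and> u)"
    and "(x \<^bold>\<oplus> y) \<^bold>\<and> u = (x \<^bold>\<and> u) \<^bold>\<oplus> (y \<^bold>\<and> u)"
  using meet_join_distrib[of u x y] idem_meet_plus[OF u_idem, of x y] meet_meet_distrib[of u x y]
  by (simp_all add: meet_comm[of _ u])

text \<open>The square of \<open>r x \<and> u\<close> lies below the square of \<open>r x\<close>,
  which is \<open>x\<close>, and below \<open>u\<close>; maximality of the root gives the nontrivial
  inequality.\<close>

lemma r_meet_u:
  assumes [simp]: "x \<in> carrier M"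
  shows "r x \<^bold>\<and> u = r (x \<^bold>\<and> u)"
proof (rule le_antisym)
  show "r (x \<^bold>\<and> u) \<^bold>\<le> r x \<^bold>\<and> u"
    by (intro meet_greatest r_mono r_segment) auto
  obtain a where a: "a \<in> emv_idem M" "r x \<^bold>\<le> a" using idem_cofinal[of "r x"] by auto
  note [simp] = idem_closed[OF a(1)]
  let ?y = "r x \<^bold>\<and> u"
  have ya: "?y \<^bold>\<le> a" using le_trans[of ?y "r x" a] a by simp
  have "?y \<^bold>\<ominus> (a \<^bold>\<ominus> ?y) \<^bold>\<le> x"
    using square_mono[OF a(1), of ?y "r x"] r_square[OF a(1) _ a(2)] by simp
  moreover have "?y \<^bold>\<ominus> (a \<^bold>\<ominus> ?y) \<^bold>\<le> u" by (rule le_trans[of _ ?y]) auto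
  ultimately show "?y \<^bold>\<le> r (x \<^bold>\<and> u)"
    using ya by (intro r_greatest[OF a(1)]) (auto intro: meet_greatest)
qed auto

text \<open>The part of \<open>r x\<close> outside \<open>u\<close> is idempotent, so it equals its
  own square and is at most \<open>x\<close>: the root acts as the identity on the Boolean
  component.\<close>

lemma r_minus_u:
  assumes [simp]: "x \<in> carrier M"
  shows "r x \<^bold>\<ominus> u = x \<^bold>\<ominus> u"
proof (rule le_antisym)
  show "x \<^bold>\<ominus> u \<^bold>\<le> r x \<^bold>\<ominus> u" by (rule minus_mono) (auto simp: le_r)
  obtain a where a: "a \<in> emv_idem M" "r x \<^bold>\<le> a" using idem_cofinal[of "r x"] by auto
  note [simp] = idem_closed[OF a(1)]
  define y where "y = r x \<^bold>\<ominus> u"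
  have [simp]: "y \<in> carrier M" and yr: "y \<^bold>\<le> r x" by (auto simp: y_def)
  have ya: "y \<^bold>\<le> a" by (rule le_trans[OF yr a(2)]) auto
  have yu: "y \<^bold>\<and> u = \<^bold>\<zero>" by (simp add: y_def minus_u_meet)
  then have "y \<^bold>\<oplus> y = y" by (simp add: disjoint_idem)
  then have y: "y \<in> emv_idem M" by (simp add: emv_idem_def)
  \<comment> \<open>The square of \<open>y\<close> is computed in the smaller segment
    \<open>[0,y]\<close>, where the complement of \<open>y\<close> is \<open>0\<close>.\<close>
  have "y \<^bold>\<ominus> (a \<^bold>\<ominus> y) = y"
    using odot_indep[OF y a(1) ya, of y y] minus_eq_zero_iff[of y y] by simp
  then have "y \<^bold>\<le> x"
    using square_mono[OF a(1) _ _ yr] r_square[OF a(1) _ a(2)] by simp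
  then have "y \<^bold>\<ominus> u \<^bold>\<le> x \<^bold>\<ominus> u" by (intro minus_mono) auto
  then show "r x \<^bold>\<ominus> u \<^bold>\<le> x \<^bold>\<ominus> u"
    using minus_u_disjoint[of y] yu by (simp add: y_def)
qed auto

section \<open>The two factors\<close>

definition "boolean_factor = sub_emv M {x \<in> carrier M. x \<^bold>\<and> u = \<^bold>\<zero>}"

definition "strict_factor = sub_emv M (emv_segment M u)"

lemma generalized_boolean_factor: "generalized_boolean_emv boolean_factor"
proof -
  let ?B = "{x \<in> carrier M. x \<^bold>\<and> u = \<^bold>\<zero>}"
  have B: "x \<in> emv_idem M" if "x \<in> ?B" for x
    using that disjoint_idem by (simp add: emv_idem_def)
  have down: "x \<in> ?B" if "x \<in> carrier M" "x \<^bold>\<le> y" "y \<in> ?B" for x y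
  proof -
    have "x \<^bold>\<and> u \<^bold>\<le> y \<^bold>\<and> u"
      using that le_trans[of "x \<^bold>\<and> u" x y] by (intro meet_greatest) auto
    then show ?thesis using that le_zero[of "x \<^bold>\<and> u"] by auto
  qed
  have B_closed: "x \<^bold>\<or> y \<in> ?B" "x \<^bold>\<and> y \<in> ?B" if "x \<in> ?B" "y \<in> ?B" for x y
    using that down[of "x \<^bold>\<and> y" x] by (auto simp: meet_u_ops join_idem)
  interpret B: distrib_lattice_bot boolean_factor
    unfolding boolean_factor_def
    by (rule distrib_lattice_bot_sub_emv) (use B_closed le_zero[of "\<^bold>\<zero> \<^bold>\<and> u"] in auto)
  show ?thesis
  proof (unfold_locales, unfold boolean_factor_def sub_emv_simps)
    fix x y assume xy: "x \<in> ?B" "y \<in> ?B"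
    then have [simp]: "x \<in> carrier M" "y \<in> carrier M" by auto
    have "x \<^bold>\<or> y \<in> emv_idem M" by (rule B[OF B_closed(1)[OF xy]])
    then show "x \<^bold>\<oplus> y = x \<^bold>\<or> y"
      by (intro le_antisym plus_le_idem join_least) auto
  next
    fix a b x assume B': "a \<in> ?B" "b \<in> ?B" "x \<in> ?B" and ax: "a \<^bold>\<le> x" and xb: "x \<^bold>\<le> b"
    then have [simp]: "a \<in> carrier M" "b \<in> carrier M" "x \<in> carrier M" by auto
    have ab: "a \<^bold>\<le> b" using le_trans[OF ax xb] by simp
    \<comment> \<open>The complement of \<open>x\<close> in \<open>[a,b]\<close> is
      \<open>a \<or> (b \<ominus> x)\<close>: the complement in \<open>[0,b]\<close>, raised to
      contain \<open>a\<close>.\<close>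
    let ?w = "b \<^bold>\<ominus> x"
    note c = idem_meet_compl[OF B[OF B'(3)] B[OF B'(2)] xb] idem_join_compl[OF B[OF B'(3)] B[OF B'(2)] xb]
    have "x \<^bold>\<and> (a \<^bold>\<or> ?w) = a"
      using le_iff_meet[of a x] ax c(1) join_comm[of a "\<^bold>\<zero>"] by (simp add: meet_join_distrib meet_comm[of x a])
    moreover have "x \<^bold>\<or> (a \<^bold>\<or> ?w) = b"
      using ax c(2) ab by (simp add: join_assoc[symmetric] join_comm[of x a] le_iff_join)
    moreover have "a \<^bold>\<or> ?w \<in> ?B"
      using B_closed(1)[OF B'(1) down[OF _ _ B'(2), of ?w]] by simp
    ultimately show "\<exists>y\<in>?B. x \<^bold>\<and> y = a \<and> x \<^bold>\<or> y = b" by blast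
  qed
qed

lemma emv_algebra_strict_factor: "emv_algebra strict_factor"
  unfolding strict_factor_def by (rule emv_algebra_sub_segment[OF u_idem])

lemma square_root_strict_factor: "emv_square_root strict_factor r"
  unfolding emv_square_root_def
proof (intro conjI ballI impI)
  show "r \<in> carrier strict_factor \<rightarrow> carrier strict_factor"
    by (auto simp: strict_factor_def mem_segment r_segment)
  show "emv_odot strict_factor (r x) (r x) = x" if "x \<in> carrier strict_factor" for x
    using that root unfolding strict_factor_def
    by (simp add: odot_sub_segment[OF u_idem] mem_segment r_segment emv_square_root_def)
  show "y \<^bold>\<le>\<^bsub>strict_factor\<^esub> r x"
    if "x \<in> carrier strict_factor" "y \<in> carrier strict_factor" "emv_odot strict_factor y y \<^bold>\<le>\<^bsub>strict_factor\<^esub> x"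
    for x y
    using that root unfolding strict_factor_def
    by (simp add: odot_sub_segment[OF u_idem] mem_segment emv_square_root_def)
qed

text \<open>\<open>u\<close> is the least idempotent above \<open>r 0\<close> and also the top of
  the strict factor, so the condition has to be checked only at \<open>b = f u\<close>, where it
  reads \<open>u \<ominus> r 0 = r 0\<close>.\<close>

lemma strict_root_image:
  assumes f: "f \<in> emv_iso strict_factor N"
  shows "\<exists>s. strict_emv_algebra N s"
proof -
  interpret S: emv_algebra strict_factor by (rule emv_algebra_strict_factor)
  interpret f: emv_isomorphism strict_factor N f by unfold_locales (rule f)
  define s where "s y = f (r (inv_into (carrier strict_factor) f y))" for y
  have seg: "carrier strict_factor = emv_segment M u" by (simp add: strict_factor_def)
  have zero: "\<^bold>\<zero>\<^bsub>strict_factor\<^esub> = \<^bold>\<zero>" by (simp add: strict_factor_def)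
  have mem: "\<^bold>\<zero> \<in> carrier strict_factor" "r \<^bold>\<zero> \<in> carrier strict_factor" "u \<in> carrier strict_factor"
    by (simp_all add: seg mem_segment)
  have s0: "s \<^bold>\<zero>\<^bsub>N\<^esub> = f (r \<^bold>\<zero>)"
    using mem(1) by (simp add: s_def f.f_zero zero inv_into_f_f inj_on_def)
  have "emv_root_restrict N s b \<^bold>\<zero>\<^bsub>N\<^esub> = emv_lam N b (emv_root_restrict N s b \<^bold>\<zero>\<^bsub>N\<^esub>)"
    if b: "b \<in> emv_idem N" "s \<^bold>\<zero>\<^bsub>N\<^esub> \<^bold>\<le>\<^bsub>N\<^esub> b" for b
  proof -
    obtain a where a: "a \<in> emv_idem strict_factor" "b = f a" using b(1) by (auto simp: f.idem_image)
    then have a': "a \<in> emv_idem M" "a \<^bold>\<le> u"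
      by (auto simp: strict_factor_def idem_sub_segment[OF u_idem])
    have "r \<^bold>\<zero> \<^bold>\<le> a"
      using b(2) mem S.idem_closed[OF a(1)] by (simp add: s0 a(2)) (simp add: strict_factor_def)
    then have "u \<^bold>\<le> a" by (simp add: u_le_iff a'(1))
    then have "a = u" using a' idem_closed[of a] by (intro le_antisym) auto
    then have bu: "b = f u" and ui: "u \<in> emv_idem strict_factor" using a by auto
    have "emv_root_restrict N s b \<^bold>\<zero>\<^bsub>N\<^esub> = f (r \<^bold>\<zero>)"
      using mem le_iff_meet[of "r \<^bold>\<zero>" u]
      by (simp add: emv_root_restrict_def s0 bu) (simp add: strict_factor_def)
    moreover have "emv_lam N b (f (r \<^bold>\<zero>)) = f (r \<^bold>\<zero>)"
      using f.f_lam[OF ui mem(2)]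
      by (simp add: bu strict_factor_def lam_sub_segment[OF u_idem] lam_eq_minus u_idem strict_r_zero)
    ultimately show ?thesis by simp
  qed
  moreover have "emv_square_root N s"
    using f.square_root_image[OF square_root_strict_factor] by (simp add: s_def[abs_def])
  ultimately show ?thesis
    unfolding strict_emv_algebra_def using f.emv_algebra_image by blast
qed

text \<open>The pair \<open>(x, f y)\<close> is the image of \<open>x \<or> y\<close>; injectivity
  holds because the two components of an element rebuild it by a join.\<close>

lemma decomposition_iso:
  assumes f: "f \<in> emv_iso strict_factor N"
  shows "(\<lambda>x. (x \<^bold>\<ominus> u, f (x \<^bold>\<and> u))) \<in> emv_iso M (emv_prod boolean_factor N)"
proof -
  interpret S: emv_algebra strict_factor by (rule emv_algebra_strict_factor)
  interpret f: emv_isomorphism strict_factor N f by unfold_locales (rule f)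
  let ?\<phi> = "\<lambda>x. (x \<^bold>\<ominus> u, f (x \<^bold>\<and> u))"
  have mem: "x \<^bold>\<and> u \<in> carrier strict_factor" if "x \<in> carrier M" for x
    using that by (simp add: strict_factor_def mem_segment)
  have ops: "f (x \<^bold>\<and> u) \<^bold>\<or>\<^bsub>N\<^esub> f (y \<^bold>\<and> u) = f ((x \<^bold>\<or> y) \<^bold>\<and> u)"
      "f (x \<^bold>\<and> u) \<^bold>\<and>\<^bsub>N\<^esub> f (y \<^bold>\<and> u) = f ((x \<^bold>\<and> y) \<^bold>\<and> u)"
      "f (x \<^bold>\<and> u) \<^bold>\<oplus>\<^bsub>N\<^esub> f (y \<^bold>\<and> u) = f ((x \<^bold>\<oplus> y) \<^bold>\<and> u)"
    if [simp]: "x \<in> carrier M" "y \<in> carrier M" for x y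
    by (simp_all add: mem) (simp_all add: strict_factor_def meet_u_ops)
  have "bij_betw ?\<phi> (carrier M) (carrier (emv_prod boolean_factor N))"
  proof (rule bij_betw_imageI)
    show "inj_on ?\<phi> (carrier M)"
    proof (rule inj_onI)
      fix x y assume xy: "x \<in> carrier M" "y \<in> carrier M" "?\<phi> x = ?\<phi> y"
      then have "x \<^bold>\<ominus> u = y \<^bold>\<ominus> u" "x \<^bold>\<and> u = y \<^bold>\<and> u" by (simp_all add: mem)
      then show "x = y" using minus_u_join_meet xy(1,2) by metis
    qed
    have "p \<in> ?\<phi> ` carrier M" if mem_p: "p \<in> carrier (emv_prod boolean_factor N)" for p
    proof -
      obtain x q where q: "p = (x, q)" "q \<in> carrier N" and x[simp]: "x \<in> carrier M" "x \<^bold>\<and> u = \<^bold>\<zero>"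
        using mem_p by (auto simp: emv_prod_def boolean_factor_def)
      then obtain y where "q = f y" "y \<in> carrier strict_factor" using f.f_image by blast
      with q have p: "p = (x, f y)" and y[simp]: "y \<in> carrier M" "y \<^bold>\<le> u"
        by (simp_all add: strict_factor_def mem_segment)
      have "y \<^bold>\<ominus> u = \<^bold>\<zero>" by (simp add: minus_eq_zero_iff)
      then have "(x \<^bold>\<or> y) \<^bold>\<ominus> u = x"
        using minus_u_disjoint join_comm[of x "\<^bold>\<zero>"] by (simp add: minus_u_ops)
      moreover have "(x \<^bold>\<or> y) \<^bold>\<and> u = y"
        using le_iff_meet[of y u] by (simp add: meet_u_ops)
      ultimately show ?thesis
        unfolding p by (intro image_eqI[of _ _ "x \<^bold>\<or> y"]) auto
    qed
    then show "?\<phi> ` carrier M = carrier (emv_prod boolean_factor N)"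
      by (auto simp: emv_prod_def boolean_factor_def minus_u_meet mem)
  qed
  moreover have "\<^bold>\<zero> \<^bold>\<ominus> u = \<^bold>\<zero>" "\<^bold>\<zero> \<^bold>\<and> u = \<^bold>\<zero>"
    using minus_eq_zero_iff[of "\<^bold>\<zero>" u] le_zero[of "\<^bold>\<zero> \<^bold>\<and> u"] by simp_all
  ultimately show ?thesis
    by (simp add: emv_iso_def emv_prod_def ops minus_u_ops)
       (simp add: boolean_factor_def f.f_zero strict_factor_def)
qed

end

theorem theorem5p15:
  fixes M :: "'a emv" and r :: "'a \<Rightarrow> 'a"
  assumes "proper_emv_algebra M"
    and "emv_square_root M r"
    and "\<^bold>\<zero>\<^bsub>M\<^esub> \<^bold><\<^bsub>M\<^esub> r \<^bold>\<zero>\<^bsub>M\<^esub>"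
  shows "\<exists>(M\<^sub>1 :: 'a emv) (G\<^sub>2 :: 'a unital_lgroup_over) u\<^sub>2 \<phi>.
    generalized_boolean_emv M\<^sub>1 \<and>
    abelian_unital_lgroup G\<^sub>2 u\<^sub>2 \<and>
    (\<exists>s. strict_emv_algebra (mv_Gamma G\<^sub>2 u\<^sub>2) s) \<and>
    \<phi> \<in> emv_iso M (emv_prod M\<^sub>1 (mv_Gamma G\<^sub>2 u\<^sub>2)) \<and>
    (\<forall>x \<in> carrier M. \<forall>x\<^sub>1 x\<^sub>2. \<phi> x = (x\<^sub>1, x\<^sub>2) \<longrightarrow>
      lg_has_half G\<^sub>2 (x\<^sub>2 \<otimes>\<^bsub>G\<^sub>2\<^esub> u\<^sub>2) \<and>
      lg_half G\<^sub>2 (x\<^sub>2 \<otimes>\<^bsub>G\<^sub>2\<^esub> u\<^sub>2) \<in> carrier (mv_Gamma G\<^sub>2 u\<^sub>2) \<and>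
      \<phi> (r x) = (x\<^sub>1, lg_half G\<^sub>2 (x\<^sub>2 \<otimes>\<^bsub>G\<^sub>2\<^esub> u\<^sub>2)) \<and>
      \<phi> (r x) = (x\<^sub>1, \<^bold>\<zero>\<^bsub>mv_Gamma G\<^sub>2 u\<^sub>2\<^esub>)
        \<^bold>\<or>\<^bsub>emv_prod M\<^sub>1 (mv_Gamma G\<^sub>2 u\<^sub>2)\<^esub> (\<^bold>\<zero>\<^bsub>M\<^sub>1\<^esub>, lg_half G\<^sub>2 (x\<^sub>2 \<otimes>\<^bsub>G\<^sub>2\<^esub> u\<^sub>2)))"
proof -
  interpret emv_root M r
    using assms by (simp add: proper_emv_algebra_def emv_root_def emv_root_axioms_def)
  interpret strict_emv_halving M u "\<lambda>x. u \<^bold>\<ominus>\<^bsub>M\<^esub> r (u \<^bold>\<ominus>\<^bsub>M\<^esub> x)" by (rule strict_halving)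
  interpret ml: midpoint_lattice "emv_segment M u" "le (emv_order M)" "emv_join M" "emv_meet M" mid
    "\<lambda>x. u \<^bold>\<ominus>\<^bsub>M\<^esub> x" "\<^bold>\<zero>\<^bsub>M\<^esub>" u by (rule midpoint_lattice_segment)
  let ?\<Gamma> = "mv_Gamma ml.G (ml.cls 0 u)"
  let ?\<phi> = "\<lambda>x. (x \<^bold>\<ominus>\<^bsub>M\<^esub> u, ml.iota (x \<^bold>\<and>\<^bsub>M\<^esub> u))"
  have "ml.iota \<in> emv_iso \<lparr>carrier = emv_segment M u, emv_join = emv_join M, emv_meet = emv_meet M,
      emv_plus = emv_plus M, emv_zero = \<^bold>\<zero>\<^bsub>M\<^esub>\<rparr> ?\<Gamma>"
  proof (rule ml.iota_iso)
    fix x y assume "x \<in> emv_segment M u" "y \<in> emv_segment M u"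
    then have xy: "x \<in> carrier M" "x \<^bold>\<le>\<^bsub>M\<^esub> u" "y \<in> carrier M" "y \<^bold>\<le>\<^bsub>M\<^esub> u"
      by (simp_all add: mem_segment)
    then show "x \<^bold>\<oplus>\<^bsub>M\<^esub> y \<in> emv_segment M u" by (simp add: mem_segment)
    \<comment> \<open>\<open>mid p 0\<close> is \<open>h p\<close> and the centre is
      \<open>h u\<close>, so this is \<open>h_plus_meet\<close>.\<close>
    show "mid (x \<^bold>\<oplus>\<^bsub>M\<^esub> y) \<^bold>\<zero>\<^bsub>M\<^esub> = mid x y \<^bold>\<and>\<^bsub>M\<^esub> ml.ctr"
      using h_plus_meet[OF xy] h_zero xy by (simp add: ml.ctr_def)
  qed
  then have iota: "ml.iota \<in> emv_iso strict_factor ?\<Gamma>"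
    by (simp add: strict_factor_def sub_emv_def)
  interpret \<Gamma>: emv_isomorphism strict_factor ?\<Gamma> ml.iota
    by (intro emv_isomorphism.intro emv_isomorphism_axioms.intro emv_algebra_strict_factor iota)
  interpret \<Gamma>L: distrib_lattice_bot ?\<Gamma> by (rule \<Gamma>.distrib_lattice_bot_image)
  interpret B: generalized_boolean_emv boolean_factor by (rule generalized_boolean_factor)
  have root: "lg_has_half ml.G (ml.iota (x \<^bold>\<and>\<^bsub>M\<^esub> u) \<otimes>\<^bsub>ml.G\<^esub> ml.cls 0 u)"
    "lg_half ml.G (ml.iota (x \<^bold>\<and>\<^bsub>M\<^esub> u) \<otimes>\<^bsub>ml.G\<^esub> ml.cls 0 u) = ml.iota (r x \<^bold>\<and>\<^bsub>M\<^esub> u)"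
    if x[simp]: "x \<in> carrier M" for x
  proof -
    let ?x = "x \<^bold>\<and>\<^bsub>M\<^esub> u"
    have mem: "?x \<in> emv_segment M u" by (simp add: mem_segment)
    then show "lg_has_half ml.G (ml.iota ?x \<otimes>\<^bsub>ml.G\<^esub> ml.cls 0 u)" by (rule ml.half_iota)
    \<comment> \<open>The half of \<open>iota ?x + u\<close> is the image of the midpoint of
      \<open>?x\<close> and \<open>u\<close>, which is the root.\<close>
    have "mid ?x u = r ?x" by (simp add: mid_top_eq_r)
    then show "lg_half ml.G (ml.iota ?x \<otimes>\<^bsub>ml.G\<^esub> ml.cls 0 u) = ml.iota (r x \<^bold>\<and>\<^bsub>M\<^esub> u)"
      using ml.half_iota(2)[OF mem] by (simp add: r_meet_u)
  qed
  \<comment> \<open>Stated for \<open>r x\<close>, whose Boolean component is that of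
    \<open>x\<close> by \<open>r_minus_u\<close>.\<close>
  have "r x \<^bold>\<ominus>\<^bsub>M\<^esub> u \<in> carrier boolean_factor" "ml.iota (r x \<^bold>\<and>\<^bsub>M\<^esub> u) \<in> carrier ?\<Gamma>"
    if "x \<in> carrier M" for x
    using that minus_u_meet[of "r x"]
    by (simp_all add: boolean_factor_def strict_factor_def mem_segment)
  then have "(x \<^bold>\<ominus>\<^bsub>M\<^esub> u, \<^bold>\<zero>\<^bsub>?\<Gamma>\<^esub>) \<^bold>\<or>\<^bsub>emv_prod boolean_factor ?\<Gamma>\<^esub>
      (\<^bold>\<zero>\<^bsub>boolean_factor\<^esub>, ml.iota (r x \<^bold>\<and>\<^bsub>M\<^esub> u)) = ?\<phi> (r x)"
    "ml.iota (r x \<^bold>\<and>\<^bsub>M\<^esub> u) \<in> carrier ?\<Gamma>" if "x \<in> carrier M" for x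
    using that B.join_comm[of "x \<^bold>\<ominus>\<^bsub>M\<^esub> u" "\<^bold>\<zero>\<^bsub>boolean_factor\<^esub>"] by (simp_all add: emv_prod_def r_minus_u)
  moreover have "\<exists>s. strict_emv_algebra ?\<Gamma> s" by (rule strict_root_image[OF iota])
  moreover have "?\<phi> \<in> emv_iso M (emv_prod boolean_factor ?\<Gamma>)" by (rule decomposition_iso[OF iota])
  ultimately show ?thesis
    using generalized_boolean_factor ml.abelian_unital_lgroup_midpoint_group root
    by (intro exI[of _ boolean_factor] exI[of _ ml.G] exI[of _ "ml.cls 0 u"] exI[of _ ?\<phi>])
       (simp add: r_minus_u)
qed

end
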